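(* Let $N\ge 2$, $J\in\mathbb{R}\setminus\{0\}$, $H_0=\sum_{n=1}^{N-1}Z_nZ_{n+1}$ and $H_1=\sum_{n=1}^{N}X_n$ on $(\mathbb{C}^2)^{\otimes N}$, and consider the controlled Schrödinger equation $\frac{d}{dt}|\psi(t)\rangle=-iJ[H_0+f(t)H_1]|\psi(t)\rangle$ with real-valued control $f$. Let $\mathfrak{L}$ be its dynamical Lie algebra and $e^{\mathfrak{L}}$ the corresponding dynamical Lie group. Let $|\psi(0)\rangle$ and $|\psi_d\rangle$ be unit vectors in $(\mathbb{C}^2)^{\otimes N}$. If $e^{\mathfrak{L}}$ is compact and $|\psi_d\rangle$ is asymptotically reachable from $|\psi(0)\rangle$, then $|\psi_d\rangle$ is reachable from $|\psi(0)\rangle$ in finite time.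
   Context: $X=\begin{pmatrix}0&1\\1&0\end{pmatrix}$ and $Z=\begin{pmatrix}1&0\\0&-1\end{pmatrix}$ are Pauli matrices; $X_n$, $Z_n$ denote the operator acting as $X$, respectively $Z$, on the $n$-th tensor factor and as the identity on the other factors. Admissible controls are locally integrable functions $f:[0,\infty)\to\mathbb{R}$ (in particular, piecewise constant functions are admissible). The dynamical Lie algebra $\mathfrak{L}$ is the real Lie algebra of skew-Hermitian matrices generated by $iH_0$ and $iH_1$. The dynamical Lie group $e^{\mathfrak{L}}$ is the connected Lie subgroup of the unitary group $\mathbf{U}(2^N)$ with Lie algebra $\mathfrak{L}$; compactness is meant with respect to the topology of $\mathbf{U}(2^N)$. States are identified up to a global phase. $|\psi_d\rangle$ is asymptotically reachable from $|\psi(0)\rangle$ if there is an admissible control $f$ on $[0,\infty)$ whose solution $|\psi(t)\rangle$ starting at $|\psi(0)\rangle$ satisfies $|\langle\psi_d|\psi(t)\rangle|^2\to1$ as $t\to+\infty$. $|\psi_d\rangle$ is reachable from $|\psi(0)\rangle$ in finite time if there exist a finite $T\geq 0$ and an admissible control whose solution starting at $|\psi(0)\rangle$ satisfies $|\langle\psi_d|\psi(T)\rangle|^2=1$. *)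

theory Defs
  imports "HOL-Analysis.Analysis"
begin

text \<open>
  The space \<open>(\<complex>\<^sup>2)\<^sup>\<otimes>\<^sup>N\<close> is \<open>complex ^ ('n \<Rightarrow> 2)\<close>, where the type \<open>'n\<close> labels the tensor factors
  and a function \<open>b :: 'n \<Rightarrow> 2\<close> stands for the product basis vector with factors \<open>e\<^bsub>b m\<^esub>\<close>.
  As in the libraries, the two indices of the type \<open>2\<close> are written 1 and 2 (where \<open>2 = 0\<close>).
\<close>

definition pauli_X :: "complex ^ 2 ^ 2" where
  "pauli_X = vector [vector [0, 1], vector [1, 0]]"

definition pauli_Z :: "complex ^ 2 ^ 2" where
  "pauli_Z = vector [vector [1, 0], vector [0, -1]]"

definition tensor_op :: "('n::finite \<Rightarrow> complex ^ 2 ^ 2) \<Rightarrow> complex ^ ('n \<Rightarrow> 2) ^ ('n \<Rightarrow> 2)" where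
  "tensor_op A = (\<chi> b c. \<Prod>m\<in>UNIV. A m $ b m $ c m)"

definition site_op :: "'n::finite \<Rightarrow> complex ^ 2 ^ 2 \<Rightarrow> complex ^ ('n \<Rightarrow> 2) ^ ('n \<Rightarrow> 2)" where
  "site_op k A = tensor_op (\<lambda>m. if m = k then A else mat 1)"

text \<open>
  In the two Hamiltonians, \<open>site\<close> enumerates the tensor factors along the chain; it is meant to be
  a bijection from \<open>{1..N}\<close> onto the type \<open>'n\<close>.
\<close>

definition ising_H0 :: "nat \<Rightarrow> (nat \<Rightarrow> 'n::finite) \<Rightarrow> complex ^ ('n \<Rightarrow> 2) ^ ('n \<Rightarrow> 2)" where
  "ising_H0 N site =
     (\<Sum>n = 1..N - 1. site_op (site n) pauli_Z ** site_op (site (n + 1)) pauli_Z)"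

definition ising_H1 :: "nat \<Rightarrow> (nat \<Rightarrow> 'n::finite) \<Rightarrow> complex ^ ('n \<Rightarrow> 2) ^ ('n \<Rightarrow> 2)" where
  "ising_H1 N site = (\<Sum>n = 1..N. site_op (site n) pauli_X)"

definition cscale :: "complex \<Rightarrow> complex ^ 'b ^ 'b \<Rightarrow> complex ^ 'b ^ 'b" where
  "cscale c A = (\<chi> i j. c * A $ i $ j)"

definition braket :: "complex ^ 'b::finite \<Rightarrow> complex ^ 'b \<Rightarrow> complex" where
  "braket u v = (\<Sum>i\<in>UNIV. cnj (u $ i) * v $ i)"

text \<open>
  \<open>subspace\<close> is meant over the reals, so the following is a real Lie algebra.  It consists of
  skew-Hermitian matrices whenever \<open>H0\<close> and \<open>H1\<close> are Hermitian.
\<close>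

definition lie_subalgebra :: "(complex ^ 'b::finite ^ 'b) set \<Rightarrow> bool" where
  "lie_subalgebra L \<longleftrightarrow> subspace L \<and> (\<forall>A\<in>L. \<forall>B\<in>L. A ** B - B ** A \<in> L)"

definition dynamical_lie_algebra ::
    "complex ^ 'b::finite ^ 'b \<Rightarrow> complex ^ 'b ^ 'b \<Rightarrow> (complex ^ 'b ^ 'b) set" where
  "dynamical_lie_algebra H0 H1 = lie_subalgebra hull {cscale \<i> H0, cscale \<i> H1}"

definition matrix_exp :: "complex ^ 'b::finite ^ 'b \<Rightarrow> complex ^ 'b ^ 'b" where
  "matrix_exp A = (\<Sum>k. (1 / fact k) *\<^sub>R (((**) A ^^ k) (mat 1)))"

text \<open>
  The connected (immersed, not necessarily closed) Lie subgroup with Lie algebra \<open>L\<close>: the group of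
  all finite products \<open>exp A\<^sub>1 \<cdots> exp A\<^sub>m\<close> with factors \<open>A\<^sub>i \<in> L\<close>.  It is closed under inverses
  because \<open>L = - L\<close>.
\<close>

inductive_set lie_group_of :: "(complex ^ 'b::finite ^ 'b) set \<Rightarrow> (complex ^ 'b ^ 'b) set"
  for L :: "(complex ^ 'b::finite ^ 'b) set" where
  one: "mat 1 \<in> lie_group_of L"
| mult: "A \<in> L \<Longrightarrow> U \<in> lie_group_of L \<Longrightarrow> matrix_exp A ** U \<in> lie_group_of L"

text \<open>Local integrability on \<open>[0, \<infinity>)\<close> in the sense of Lebesgue.\<close>

definition admissible_control :: "(real \<Rightarrow> real) \<Rightarrow> bool" where
  "admissible_control f \<longleftrightarrow> (\<forall>T\<ge>0. f absolutely_integrable_on {0..T})"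

text \<open>
  For a merely locally integrable control the differential equation
  \<open>\<psi>' = - i J (H0 + f(t) H1) \<psi>\<close> is understood in the sense of Caratheodory: \<open>\<psi>\<close> is continuous
  and satisfies the integrated equation on \<open>[0, \<infinity>)\<close>.
\<close>

definition schroedinger_solution ::
    "real \<Rightarrow> complex ^ 'b::finite ^ 'b \<Rightarrow> complex ^ 'b ^ 'b \<Rightarrow> (real \<Rightarrow> real)
      \<Rightarrow> (real \<Rightarrow> complex ^ 'b) \<Rightarrow> bool" where
  "schroedinger_solution J H0 H1 f \<psi> \<longleftrightarrow>
     continuous_on {0..} \<psi> \<and>
     (\<forall>t\<ge>0. ((\<lambda>s. (- \<i> * of_real J) *s ((H0 + f s *\<^sub>R H1) *v \<psi> s)) has_integral (\<psi> t - \<psi> 0)) {0..t})"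

definition asymptotically_reachable ::
    "real \<Rightarrow> complex ^ 'b::finite ^ 'b \<Rightarrow> complex ^ 'b ^ 'b
      \<Rightarrow> complex ^ 'b \<Rightarrow> complex ^ 'b \<Rightarrow> bool" where
  "asymptotically_reachable J H0 H1 \<psi>0 \<psi>d \<longleftrightarrow>
     (\<exists>f \<psi>. admissible_control f \<and> schroedinger_solution J H0 H1 f \<psi> \<and> \<psi> 0 = \<psi>0 \<and>
        ((\<lambda>t. (cmod (braket \<psi>d (\<psi> t)))\<^sup>2) \<longlongrightarrow> 1) at_top)"

definition finite_time_reachable ::
    "real \<Rightarrow> complex ^ 'b::finite ^ 'b \<Rightarrow> complex ^ 'b ^ 'b
      \<Rightarrow> complex ^ 'b \<Rightarrow> complex ^ 'b \<Rightarrow> bool" where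
  "finite_time_reachable J H0 H1 \<psi>0 \<psi>d \<longleftrightarrow>
     (\<exists>T\<ge>0. \<exists>f \<psi>. admissible_control f \<and> schroedinger_solution J H0 H1 f \<psi> \<and> \<psi> 0 = \<psi>0 \<and>
        (cmod (braket \<psi>d (\<psi> T)))\<^sup>2 = 1)"

end

theory Submission
  imports Defs
begin

text \<open>
  Let \<open>G\<close> be the compact group with Lie algebra \<open>L\<close>.  The solution at time \<open>t\<close> lies in the orbit
  \<open>G \<psi>(0)\<close>, so by compactness an asymptotically reachable state is, up to a phase, \<open>U \<psi>(0)\<close> with
  \<open>U \<in> G\<close>.  It remains to see that every \<open>U \<in> G\<close> is a product of factors
  \<open>exp (- \<i> t J (H0 + u H1))\<close> with \<open>t \<ge> 0\<close> (Jurdjevic and Sussmann).  Products of such factors depend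
  on their times through a map of full rank at some point, because the conjugates of the generators
  under the semigroup span \<open>L\<close>; hence the semigroup contains a neighbourhood of some element \<open>s\<close> in
  the intrinsic topology of \<open>G\<close> (Krener).  On the compact group \<open>G\<close> this topology is the subspace
  topology by Baire's theorem, so some power of \<open>s\<close> is intrinsically close to the identity.
  Therefore the semigroup contains a neighbourhood of the identity, which generates \<open>G\<close>.
\<close>

section \<open>The Banach algebra of endomorphisms\<close>

text \<open>Times are nonnegative, so the drift cannot be run backwards and the attainable operators
  a priori form only a semigroup; recurrence supplies the missing inverses. Recurrence is a
  statement about the norm, whereas charts control products of exponentials of small total length.
  The two notions of closeness may differ: an irrational line in a torus comes back near the
  identity while its length grows. Reconciling them is what Baire's theorem is for. The group is
  treated without manifolds. Lengths in \<open>near_one\<close> express its intrinsic topology,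
  charts are maps on a Euclidean space with derivative translated back to the Lie algebra, and in
  place of an inverse function theorem exponential paths are lifted through them by small steps,
  compactness removing the remaining error. The same continuous induction handles the controlled
  equation: a merely integrable control leaves no pointwise derivative to work with, so solutions
  are compared with exponentials of integrated generators.\<close>

text \<open>
  A copy of the bounded operators that carries the multiplicative type classes required by the
  library's \<open>exp\<close>.  Matrices act on matrices by left and right multiplication, so that facts about
  \<open>exp\<close> transfer to \<open>matrix_exp\<close>, and \<open>Ad (exp A) = exp (ad A)\<close> comes for free.
\<close>

typedef (overloaded) 'a endo = "UNIV :: ('a::euclidean_space \<Rightarrow>\<^sub>L 'a) set" ..

setup_lifting type_definition_endo

instantiation endo :: (euclidean_space) real_normed_vector
begin

lift_definition zero_endo :: "'a endo" is 0 .
lift_definition plus_endo :: "'a endo \<Rightarrow> 'a endo \<Rightarrow> 'a endo" is "(+)" .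
lift_definition minus_endo :: "'a endo \<Rightarrow> 'a endo \<Rightarrow> 'a endo" is "(-)" .
lift_definition uminus_endo :: "'a endo \<Rightarrow> 'a endo" is uminus .
lift_definition scaleR_endo :: "real \<Rightarrow> 'a endo \<Rightarrow> 'a endo" is "(*\<^sub>R)" .
lift_definition norm_endo :: "'a endo \<Rightarrow> real" is norm .
definition dist_endo :: "'a endo \<Rightarrow> 'a endo \<Rightarrow> real" where "dist_endo a b = norm (a - b)"
definition sgn_endo :: "'a endo \<Rightarrow> 'a endo" where "sgn_endo a = scaleR (inverse (norm a)) a"
definition [code del]:
  "(uniformity :: ('a endo \<times> 'a endo) filter) = (INF e\<in>{0 <..}. principal {(x, y). dist x y < e})"
definition open_endo :: "'a endo set \<Rightarrow> bool"
  where [code del]: "open_endo S = (\<forall>x\<in>S. \<forall>\<^sub>F (x', y) in uniformity. x' = x \<longrightarrow> y \<in> S)"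

instance
  by standard
    (unfold dist_endo_def sgn_endo_def uniformity_endo_def open_endo_def,
     (transfer; simp add: algebra_simps norm_triangle_ineq)+)
end

instantiation endo :: (euclidean_space) real_normed_algebra_1
begin

lift_definition one_endo :: "'a endo" is id_blinfun .
lift_definition times_endo :: "'a endo \<Rightarrow> 'a endo \<Rightarrow> 'a endo" is "(o\<^sub>L)" .

instance
proof
  fix a b c :: "'a endo" and r :: real
  show "a * b * c = a * (b * c)" "1 * a = a" "a * 1 = a"
    by (transfer; auto intro: blinfun_eqI)+
  show "(a + b) * c = a * c + b * c" "a * (b + c) = a * b + a * c"
    by (transfer; simp add: bounded_bilinear.add_left[OF bounded_bilinear_blinfun_compose]
        bounded_bilinear.add_right[OF bounded_bilinear_blinfun_compose])+
  show "r *\<^sub>R a * b = r *\<^sub>R (a * b)" "a * r *\<^sub>R b = r *\<^sub>R (a * b)"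
    by (transfer; simp add: bounded_bilinear.scaleR_left[OF bounded_bilinear_blinfun_compose]
        bounded_bilinear.scaleR_right[OF bounded_bilinear_blinfun_compose])+
  show "norm (a * b) \<le> norm a * norm b"
    by transfer (rule norm_blinfun_compose)
  show "norm (1 :: 'a endo) = 1"
    by transfer (rule norm_blinfun_id)
  show "(0 :: 'a endo) \<noteq> 1"
  proof
    assume "(0 :: 'a endo) = 1"
    then have "norm (0 :: 'a endo) = norm (1 :: 'a endo)"
      by (rule arg_cong)
    then show False
      by (simp only: \<open>norm (1 :: 'a endo) = 1\<close> norm_zero zero_neq_one)
  qed
qed
end

instance endo :: (euclidean_space) banach
proof
  fix X :: "nat \<Rightarrow> 'a endo"
  assume X: "Cauchy X"
  have dist_Rep: "dist (Rep_endo A) (Rep_endo B) = dist A B" for A B :: "'a endo"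
    unfolding dist_norm by transfer (rule refl)
  have "Cauchy (\<lambda>n. Rep_endo (X n))"
    using X unfolding Cauchy_def dist_Rep .
  then obtain l where "(\<lambda>n. Rep_endo (X n)) \<longlonglongrightarrow> Rep_endo (Abs_endo l)"
    using Cauchy_convergent_iff convergent_def by (metis Abs_endo_inverse UNIV_I)
  then have "X \<longlonglongrightarrow> Abs_endo l"
    unfolding tendsto_iff dist_Rep .
  then show "convergent X"
    unfolding convergent_def by blast
qed

definition endo_of :: "('a::euclidean_space \<Rightarrow> 'a) \<Rightarrow> 'a endo" where
  "endo_of f = Abs_endo (Blinfun f)"

definition endo_apply :: "'a::euclidean_space endo \<Rightarrow> 'a \<Rightarrow> 'a" where
  "endo_apply E = blinfun_apply (Rep_endo E)"

lemma endo_apply_of [simp]: "linear f \<Longrightarrow> endo_apply (endo_of f) = f"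
  by (simp add: endo_apply_def endo_of_def Abs_endo_inverse bounded_linear_Blinfun_apply
      linear_conv_bounded_linear)

lemma endo_eqI: "(\<And>x. endo_apply E x = endo_apply F x) \<Longrightarrow> E = F"
  by (metis Rep_endo_inject blinfun_eqI endo_apply_def)

lemma endo_apply_simps [simp]:
  "endo_apply 1 x = x" "endo_apply (E * F) x = endo_apply E (endo_apply F x)"
  "endo_apply (E + F) x = endo_apply E x + endo_apply F x"
  "endo_apply (E - F) x = endo_apply E x - endo_apply F x"
  "endo_apply (r *\<^sub>R E) x = r *\<^sub>R endo_apply E x"
  by (simp_all add: endo_apply_def one_endo.rep_eq times_endo.rep_eq plus_endo.rep_eq
      minus_endo.rep_eq scaleR_endo.rep_eq blinfun.add_left blinfun.diff_left blinfun.scaleR_left)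

lemma endo_apply_power: "endo_apply (E ^ k) x = (endo_apply E ^^ k) x"
  by (induction k) auto

lemma bounded_linear_endo_apply: "bounded_linear (\<lambda>E. endo_apply E x)"
proof (rule bounded_linear_intro)
  show "norm (endo_apply E x) \<le> norm E * norm x" for E
    by (simp add: endo_apply_def norm_endo.rep_eq norm_blinfun)
qed simp_all

lemma exp_endo_sums: "(\<lambda>k. (endo_apply E ^^ k) x /\<^sub>R fact k) sums endo_apply (exp E) x"
  using bounded_linear.sums[OF bounded_linear_endo_apply exp_converges, of E x]
  by (simp add: endo_apply_power)

text \<open>The partial sums of the series stay in \<open>V\<close>, and a subspace of a
  finite-dimensional space is closed. For \<open>V = L\<close> and a bracket operator this makes
  \<open>L\<close> invariant under conjugation.\<close>

lemma exp_endo_closed_subspace: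
  assumes V: "subspace V" and x: "x \<in> V" and inv: "\<And>y. y \<in> V \<Longrightarrow> endo_apply E y \<in> V"
  shows "endo_apply (exp E) x \<in> V"
proof -
  have "(endo_apply E ^^ k) x \<in> V" for k
    by (induction k) (auto simp: x inv)
  then have "(\<Sum>k<n. (endo_apply E ^^ k) x /\<^sub>R fact k) \<in> V" for n
    by (intro subspace_sum subspace_scale V)
  moreover have "(\<lambda>n. \<Sum>k<n. (endo_apply E ^^ k) x /\<^sub>R fact k) \<longlonglongrightarrow> endo_apply (exp E) x"
    using exp_endo_sums by (simp add: sums_def)
  ultimately show ?thesis
    using closed_sequentially[OF closed_subspace[OF V]] by metis
qed

lemma bounded_bilinear_matrix_mult:
  "bounded_bilinear ((**) :: complex^'n^'m \<Rightarrow> complex^'k^'n \<Rightarrow> complex^'k^'m)"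
proof -
  have "bilinear ((**) :: complex^'n^'m \<Rightarrow> complex^'k^'n \<Rightarrow> complex^'k^'m)"
    unfolding bilinear_def matrix_matrix_mult_def
    by (intro conjI allI linearI; simp only: vec_eq_iff)
       (simp_all only: distrib_left distrib_right sum.distrib scaleR_sum_right mult_scaleR_left
         mult_scaleR_right vector_add_component vector_scaleR_component vec_lambda_beta simp_thms)
  then show ?thesis
    by (simp add: bilinear_conv_bounded_bilinear)
qed

interpretation mm: bounded_bilinear "(**) :: complex^'n^'m \<Rightarrow> complex^'k^'n \<Rightarrow> complex^'k^'m"
  by (rule bounded_bilinear_matrix_mult)

section \<open>The matrix exponential\<close>

lemma linear_matrix_mult_left: "linear (\<lambda>X :: complex^'n^'n. A ** X)"
  by (simp add: linear_conv_bounded_linear mm.bounded_linear_right)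

lemma linear_matrix_mult_right: "linear (\<lambda>X :: complex^'n^'n. X ** A)"
  by (simp add: linear_conv_bounded_linear mm.bounded_linear_left)

definition lmul :: "complex^'n^'n \<Rightarrow> (complex^'n^'n) endo" where
  "lmul A = endo_of (\<lambda>X. A ** X)"

definition rmul :: "complex^'n^'n \<Rightarrow> (complex^'n^'n) endo" where
  "rmul A = endo_of (\<lambda>X. X ** A)"

lemma lmul_apply [simp]: "endo_apply (lmul A) X = A ** X"
  by (simp add: lmul_def linear_matrix_mult_left)

lemma rmul_apply [simp]: "endo_apply (rmul A) X = X ** A"
  by (simp add: rmul_def linear_matrix_mult_right)

lemma lmul_linear [simp]: "lmul (A + B) = lmul A + lmul B" "lmul (r *\<^sub>R A) = r *\<^sub>R lmul A"
  and rmul_linear [simp]: "rmul (A + B) = rmul A + rmul B" "rmul (r *\<^sub>R A) = r *\<^sub>R rmul A"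
  by (auto intro!: endo_eqI simp: mm.add_left mm.add_right mm.scaleR_left mm.scaleR_right)

lemma lmul_power: "(endo_apply (lmul A) ^^ k) X = ((**) A ^^ k) (mat 1) ** X"
  by (induction k) (auto simp: matrix_mul_assoc)

lemma rmul_power: "(endo_apply (rmul A) ^^ k) X = X ** ((**) A ^^ k) (mat 1)"
proof -
  have "((**) A ^^ k) (mat 1) ** A = A ** ((**) A ^^ k) (mat 1)" for k
    by (induction k) (auto simp flip: matrix_mul_assoc)
  then show ?thesis
    by (induction k) (auto simp flip: matrix_mul_assoc)
qed

lemma matrix_exp_sums: "(\<lambda>k. ((**) A ^^ k) (mat 1) /\<^sub>R fact k) sums matrix_exp A"
  and matrix_exp_lmul: "matrix_exp A ** X = endo_apply (exp (lmul A)) X"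
  and matrix_exp_rmul: "X ** matrix_exp A = endo_apply (exp (rmul A)) X"
proof -
  have "(\<lambda>k. ((**) A ^^ k) (mat 1) /\<^sub>R fact k) sums endo_apply (exp (lmul A)) (mat 1)"
    using exp_endo_sums[of "lmul A" "mat 1"] by (simp add: lmul_power)
  then show sums: "(\<lambda>k. ((**) A ^^ k) (mat 1) /\<^sub>R fact k) sums matrix_exp A"
    unfolding matrix_exp_def by (simp add: divide_inverse sums_iff)
  show "matrix_exp A ** X = endo_apply (exp (lmul A)) X"
    using bounded_linear.sums[OF mm.bounded_linear_left sums, of X] exp_endo_sums[of "lmul A" X]
    by (simp add: lmul_power mm.scaleR_left sums_unique2)
  show "X ** matrix_exp A = endo_apply (exp (rmul A)) X"
    using bounded_linear.sums[OF mm.bounded_linear_right sums, of X] exp_endo_sums[of "rmul A" X]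
    by (simp add: rmul_power mm.scaleR_right sums_unique2)
qed

lemma matrix_exp_eq: "matrix_exp A = endo_apply (exp (lmul A)) (mat 1)"
  using matrix_exp_lmul[of A "mat 1"] by simp

lemma matrix_exp_add_scaleR:
  "matrix_exp ((s + t) *\<^sub>R A) = matrix_exp (s *\<^sub>R A) ** matrix_exp (t *\<^sub>R A)"
proof -
  have "exp (lmul ((s + t) *\<^sub>R A)) = exp (s *\<^sub>R lmul A) * exp (t *\<^sub>R lmul A)"
    unfolding lmul_linear scaleR_add_left by (rule exp_add_commuting) simp
  then show ?thesis
    unfolding matrix_exp_lmul by (simp only: matrix_exp_eq endo_apply_simps lmul_linear)
qed

lemma matrix_exp_0 [simp]: "matrix_exp (0 :: complex^'n^'n) = mat 1"
proof -
  have "lmul (0 :: complex^'n^'n) = 0"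
    using lmul_linear(2)[of 0 "0 :: complex^'n^'n"] by simp
  then show ?thesis
    by (simp add: matrix_exp_eq)
qed

lemma matrix_exp_minus [simp]:
  "matrix_exp A ** matrix_exp (- A) = mat 1" "matrix_exp (- A) ** matrix_exp A = mat 1"
  using matrix_exp_add_scaleR[of 1 "-1" A] matrix_exp_add_scaleR[of "-1" 1 A] by simp_all

lemma matrix_exp_has_vector_derivative:
  "((\<lambda>t. matrix_exp (t *\<^sub>R A)) has_vector_derivative A ** matrix_exp (t *\<^sub>R A)) (at t within T)"
proof -
  have "((\<lambda>t. endo_apply (exp (t *\<^sub>R lmul A)) (mat 1)) has_vector_derivative
      endo_apply (lmul A * exp (t *\<^sub>R lmul A)) (mat 1)) (at t within T)"
    by (rule bounded_linear.has_vector_derivative[OF bounded_linear_endo_apply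
          has_vector_derivative_at_within[OF exp_scaleR_has_vector_derivative_left]])
  then show ?thesis
    by (simp add: matrix_exp_eq)
qed

lemma matrix_exp_has_vector_derivative_right:
  "((\<lambda>t. matrix_exp (t *\<^sub>R A)) has_vector_derivative matrix_exp (t *\<^sub>R A) ** A) (at t within T)"
proof -
  have "((\<lambda>t. endo_apply (exp (t *\<^sub>R lmul A)) (mat 1)) has_vector_derivative
      endo_apply (exp (t *\<^sub>R lmul A) * lmul A) (mat 1)) (at t within T)"
    by (rule bounded_linear.has_vector_derivative[OF bounded_linear_endo_apply
          exp_scaleR_has_vector_derivative_right])
  then show ?thesis
    unfolding matrix_exp_lmul by (simp add: matrix_exp_eq)
qed

lemma matrix_exp_conj:
  assumes "g ** h = mat 1" "h ** g = mat 1"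
  shows "g ** matrix_exp A ** h = matrix_exp (g ** A ** h)"
proof -
  have "((**) (g ** A ** h) ^^ k) (mat 1) = g ** ((**) A ^^ k) (mat 1) ** h" for k
  proof (induction k)
    case (Suc k)
    have "g ** A ** h ** (g ** ((**) A ^^ k) (mat 1) ** h)
        = g ** A ** (h ** g) ** ((**) A ^^ k) (mat 1) ** h"
      by (simp add: matrix_mul_assoc)
    then show ?case
      by (simp add: Suc assms matrix_mul_assoc)
  qed (simp add: assms)
  then have "(\<lambda>k. g ** (((**) A ^^ k) (mat 1) /\<^sub>R fact k) ** h) sums matrix_exp (g ** A ** h)"
    using matrix_exp_sums[of "g ** A ** h"] by (simp add: mm.scaleR_left mm.scaleR_right)
  moreover have "(\<lambda>k. g ** (((**) A ^^ k) (mat 1) /\<^sub>R fact k) ** h) sums (g ** matrix_exp A ** h)"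
    by (intro bounded_linear.sums[OF mm.bounded_linear_left] bounded_linear.sums[OF mm.bounded_linear_right]
        matrix_exp_sums)
  ultimately show ?thesis
    using sums_unique2 by blast
qed

text \<open>Left and right multiplications commute by associativity, so the exponential of
  \<open>lmul A + rmul (- A)\<close>, which is the operator \<open>ad A\<close>, splits into two
  factors.\<close>

lemma matrix_exp_Ad:
  "matrix_exp A ** X ** matrix_exp (- A) = endo_apply (exp (lmul A + rmul (- A))) X"
proof -
  have "exp (lmul A + rmul (- A)) = exp (lmul A) * exp (rmul (- A))"
    by (intro exp_add_commuting endo_eqI) (simp add: matrix_mul_assoc)
  then show ?thesis
    by (simp add: matrix_exp_lmul[symmetric] matrix_exp_rmul[symmetric] matrix_mul_assoc)
qed

lemma matrix_exp_Ad_in_lie_subalgebra: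
  assumes L: "lie_subalgebra L" and "A \<in> L" "X \<in> L"
  shows "matrix_exp A ** X ** matrix_exp (- A) \<in> L"
  unfolding matrix_exp_Ad
proof (rule exp_endo_closed_subspace)
  show "endo_apply (lmul A + rmul (- A)) Y \<in> L" if "Y \<in> L" for Y
    using L \<open>A \<in> L\<close> that by (simp add: lie_subalgebra_def mm.minus_right)
qed (use assms in \<open>auto simp: lie_subalgebra_def\<close>)

section \<open>Second-order remainder of the exponential\<close>

lemma norm_exp_minus_one_minus:
  fixes x :: "'a::{real_normed_algebra_1,banach}"
  assumes "norm x \<le> 1"
  shows "norm (exp x - 1 - x) \<le> (norm x)\<^sup>2"
proof -
  have summable: "summable (\<lambda>n. inverse (fact (n + 2)) *\<^sub>R norm x ^ (n + 2))"
    using summable_ignore_initial_segment[OF summable_exp_generic[of "norm x"], of 2] .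
  have "norm (exp x - 1 - x) = norm (\<Sum>n. inverse (fact (n + 2)) *\<^sub>R x ^ (n + 2))"
    by (subst exp_first_two_terms) simp
  also have "\<dots> \<le> (\<Sum>n. inverse (fact (n + 2)) *\<^sub>R norm x ^ (n + 2))"
    by (rule norm_suminf_le[OF _ summable])
       (auto intro!: mult_left_mono norm_power_ineq simp del: power_Suc fact_Suc)
  also have "\<dots> = exp (norm x) - 1 - norm x"
    using exp_first_two_terms[of "norm x"] by simp
  also have "\<dots> \<le> (norm x)\<^sup>2"
    using exp_bound[of "norm x"] assms by simp
  finally show ?thesis .
qed

text \<open>The quadratic order matters: over a fine subdivision such errors add up to something
  arbitrarily small. In the constant, \<open>K\<close> bounds \<open>lmul\<close> and
  \<open>D\<close> bounds evaluation at the identity matrix.\<close>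

lemma norm_matrix_exp_minus_one_minus:
  "\<exists>C>0. \<exists>\<delta>>0. \<forall>A :: complex^'n^'n. norm A \<le> \<delta> \<longrightarrow>
     norm (matrix_exp A - mat 1 - A) \<le> C * (norm A)\<^sup>2"
proof -
  have "linear (lmul :: complex^'n^'n \<Rightarrow> _)"
    by (rule linearI) simp_all
  then obtain K where K: "K > 0" "\<And>A :: complex^'n^'n. norm (lmul A) \<le> K * norm A"
    by (rule linear_bounded_pos) (rule that)
  let ?I = "mat 1 :: complex^'n^'n"
  obtain D where D: "D > 0" "\<forall>E. norm (endo_apply E ?I) \<le> norm E * D"
    using bounded_linear.pos_bounded[OF bounded_linear_endo_apply, of ?I] by (elim exE conjE)
  have "norm (matrix_exp A - ?I - A) \<le> (K\<^sup>2 * D) * (norm A)\<^sup>2" if "norm A \<le> 1 / K" for A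
  proof -
    have le: "norm (lmul A) \<le> 1"
      using that K(1) order_trans[OF K(2)[of A], of 1] by (simp add: pos_le_divide_eq mult.commute)
    have "matrix_exp A - ?I - A = endo_apply (exp (lmul A) - 1 - lmul A) ?I"
      by (simp add: matrix_exp_eq)
    also have "norm \<dots> \<le> norm (exp (lmul A) - 1 - lmul A) * D"
      by (rule D(2)[rule_format])
    also have "\<dots> \<le> (K * norm A)\<^sup>2 * D"
      using norm_exp_minus_one_minus[OF le] power_mono[OF K(2)[of A], of 2] D(1)
      by (intro mult_right_mono) auto
    also have "\<dots> = (K\<^sup>2 * D) * (norm A)\<^sup>2"
      by (simp add: power_mult_distrib)
    finally show ?thesis .
  qed
  moreover have "K\<^sup>2 * D > 0" "1 / K > 0"
    using K(1) D(1) by simp_all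
  ultimately show ?thesis
    by blast
qed

section \<open>Lifting exponential paths\<close>

text \<open>The maximum of \<open>T\<close> within the interval exists by compactness, and
  \<open>step\<close> forbids it to lie below \<open>b\<close>. Closedness takes the place of a
  uniform step size.\<close>

lemma closed_interval_induct:
  fixes T :: "real set"
  assumes "closed T" "a \<le> b" "a \<in> T"
    and step: "\<And>t. t \<in> T \<Longrightarrow> a \<le> t \<Longrightarrow> t < b \<Longrightarrow> \<exists>t'\<in>T. t < t' \<and> t' \<le> b"
  shows "b \<in> T"
proof -
  have "compact (T \<inter> {a..b})" "T \<inter> {a..b} \<noteq> {}"
    using assms by auto
  then obtain s where s: "s \<in> T" "a \<le> s" "s \<le> b" "\<And>t. t \<in> T \<Longrightarrow> a \<le> t \<Longrightarrow> t \<le> b \<Longrightarrow> t \<le> s"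
    using compact_attains_sup by (metis IntE IntI atLeastAtMost_iff)
  show ?thesis
  proof (cases "s < b")
    case True
    then obtain t' where "t' \<in> T" "s < t'" "t' \<le> b"
      using step s by blast
    then show ?thesis
      using s(2) s(4)[of t'] by linarith
  qed (use s in force)
qed

text \<open>
  Lifting the path \<open>\<tau> \<mapsto> exp (\<tau> X) F(Y\<^sub>0)\<close> through \<open>F\<close>.  Instead of solving the differential equation
  \<open>M(Y) Y' = X\<close>, the error \<open>exp (- \<tau> X) F(Y) - F(Y\<^sub>0)\<close> is kept below \<open>\<eta> \<tau>\<close> for every \<open>\<eta> > 0\<close>,
  and \<open>\<eta> \<rightarrow> 0\<close> by compactness.
\<close>

lemma lift_matrix_exp:
  fixes F :: "'a::euclidean_space \<Rightarrow> complex^'n^'n"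
  assumes der: "\<And>Y. norm Y \<le> r \<Longrightarrow> (F has_derivative (\<lambda>V. M Y V ** F Y)) (at Y)"
    and solvable: "\<And>Y. norm Y \<le> r \<Longrightarrow> \<exists>V. norm V \<le> c \<and> M Y V = X"
    and start: "norm Y0 + c \<le> r" and c: "c \<ge> 0"
  shows "\<exists>Y. norm (Y - Y0) \<le> c \<and> F Y = matrix_exp X ** F Y0"
proof -
  define E where "E = (\<lambda>(\<tau>, Y). matrix_exp (\<tau> *\<^sub>R (- X)) ** F Y - F Y0)"
  have in_ball: "norm Y \<le> r" if "norm (Y - Y0) \<le> c" for Y
    using that start norm_triangle_sub[of Y Y0] by linarith
  have cont_exp: "continuous_on UNIV (\<lambda>\<tau>. matrix_exp (\<tau> *\<^sub>R (- X)))"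
    using matrix_exp_has_vector_derivative
    by (intro continuous_at_imp_continuous_on ballI has_vector_derivative_continuous)
  have cont_F: "continuous_on (cball Y0 c) F"
    using der in_ball by (intro continuous_at_imp_continuous_on ballI has_derivative_continuous)
      (auto simp: dist_norm norm_minus_commute)
  have cont_E: "continuous_on ({0..1} \<times> cball Y0 c) E"
  proof -
    have "continuous_on ({0..1} \<times> cball Y0 c) (\<lambda>p. matrix_exp (fst p *\<^sub>R (- X)))"
      by (intro continuous_on_compose2[OF cont_exp continuous_on_fst]) (auto intro: continuous_on_id)
    moreover have "continuous_on ({0..1} \<times> cball Y0 c) (\<lambda>p. F (snd p))"
      by (intro continuous_on_compose2[OF cont_F continuous_on_snd]) (auto intro: continuous_on_id)
    ultimately show ?thesis
      unfolding E_def case_prod_beta by (intro continuous_on_diff mm.continuous_on continuous_on_const)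
  qed
  have approx: "\<exists>Y. norm (Y - Y0) \<le> c \<and> norm (E (1, Y)) \<le> \<eta>" if "\<eta> > 0" for \<eta>
  proof -
    \<comment> \<open>A pair in \<open>P\<close> is a time and a point whose displacement and error
      both fit a budget linear in the time. Linearity lets the budgets of consecutive steps add up;
      the conditions are closed, so \<open>P\<close> is compact.\<close>
    define P where "P = ({0..1} \<times> cball Y0 c) \<inter>
      (\<lambda>p. (norm (snd p - Y0) - c * fst p, norm (E p) - \<eta> * fst p)) -` ({..0} \<times> {..0})"
    have "closed P"
      unfolding P_def
      by (intro continuous_closed_preimage closed_Times closed_atMost continuous_intros cont_E) auto
    moreover have "P = ({0..1} \<times> cball Y0 c) \<inter> P"
      by (auto simp: P_def)
    ultimately have "compact P"
      by (metis compact_Int_closed compact_Icc compact_Times compact_cball)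
    then have "compact (fst ` P)"
      by (intro compact_continuous_image continuous_on_fst continuous_on_id)
    then have "closed (fst ` P)"
      by (rule compact_imp_closed)
    then have "1 \<in> fst ` P"
    proof (rule closed_interval_induct[of _ 0])
      have "(0, Y0) \<in> P"
        using c by (simp add: P_def E_def)
      then show "0 \<in> fst ` P"
        by force
      fix \<tau> assume \<tau>: "\<tau> \<in> fst ` P" "0 \<le> \<tau>" "\<tau> < 1"
      then obtain Y where Y: "norm (Y - Y0) \<le> c * \<tau>" "norm (E (\<tau>, Y)) \<le> \<eta> * \<tau>" "norm (Y - Y0) \<le> c"
        by (auto simp: P_def dist_norm norm_minus_commute)
      obtain V where V: "norm V \<le> c" "M Y V = X"
        using solvable in_ball Y(3) by blast
      define \<phi> where "\<phi> h = matrix_exp ((\<tau> + h) *\<^sub>R (- X)) ** F (Y + h *\<^sub>R V)" for h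
      have "((\<lambda>h. matrix_exp ((\<tau> + h) *\<^sub>R (- X))) has_vector_derivative
          1 *\<^sub>R (matrix_exp ((\<tau> + 0) *\<^sub>R (- X)) ** (- X))) (at 0)"
        by (rule vector_diff_chain_at[of "\<lambda>h. \<tau> + h" 1 0 "\<lambda>t. matrix_exp (t *\<^sub>R (- X))", unfolded o_def])
           (auto intro!: derivative_eq_intros matrix_exp_has_vector_derivative_right
             simp del: scaleR_minus_right)
      moreover have "((\<lambda>h. F (Y + h *\<^sub>R V)) has_vector_derivative (X ** F Y)) (at 0)"
      proof -
        have "((\<lambda>h. Y + h *\<^sub>R V) has_vector_derivative V) (at 0)"
          by (auto intro!: derivative_eq_intros)
        moreover have "(F has_derivative (\<lambda>V. M Y V ** F Y)) (at (Y + 0 *\<^sub>R V) within range (\<lambda>h. Y + h *\<^sub>R V))"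
          using der[OF in_ball[OF Y(3)]] by (simp add: has_derivative_at_withinI)
        ultimately have "((F \<circ> (\<lambda>h. Y + h *\<^sub>R V)) has_vector_derivative (M Y V ** F Y)) (at 0)"
          by (rule vector_derivative_diff_chain_within)
        then show ?thesis
          by (simp add: o_def V)
      qed
      ultimately have "(\<phi> has_vector_derivative
          matrix_exp (\<tau> *\<^sub>R (- X)) ** (X ** F Y) + (matrix_exp (\<tau> *\<^sub>R (- X)) ** (- X)) ** F Y) (at 0)"
        unfolding \<phi>_def using mm.has_vector_derivative by fastforce
      \<comment> \<open>The two terms cancel because \<open>M Y V = X\<close>: moving from
        \<open>Y\<close> with velocity \<open>V\<close> follows the exponential path to first order,
        so for small \<open>h\<close> the error grows by at most \<open>\<eta> * h\<close>.\<close>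
      then have "(\<phi> has_vector_derivative 0) (at 0)"
        by (simp add: matrix_mul_assoc mm.minus_left mm.minus_right)
      then obtain d where d: "d > 0" "\<And>h. \<bar>h\<bar> < d \<Longrightarrow> norm (\<phi> h - \<phi> 0) \<le> \<eta> * \<bar>h\<bar>"
        using \<open>\<eta> > 0\<close> unfolding has_vector_derivative_def has_derivative_at_alt by fastforce
      define h where "h = min (d / 2) (1 - \<tau>)"
      have h: "h > 0" "\<bar>h\<bar> < d" "\<tau> + h \<le> 1"
        using d \<tau> by (auto simp: h_def)
      have "E (\<tau> + h, Y + h *\<^sub>R V) = E (\<tau>, Y) + (\<phi> h - \<phi> 0)"
        by (simp add: E_def \<phi>_def)
      then have "norm (E (\<tau> + h, Y + h *\<^sub>R V)) \<le> \<eta> * \<tau> + \<eta> * h"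
        using norm_triangle_ineq[of "E (\<tau>, Y)" "\<phi> h - \<phi> 0"] Y(2) d(2)[OF h(2)] h(1) by simp
      moreover have "norm (Y + h *\<^sub>R V - Y0) \<le> c * \<tau> + c * h"
      proof -
        have "norm (Y + h *\<^sub>R V - Y0) \<le> norm (Y - Y0) + norm (h *\<^sub>R V)"
          by (metis add_diff_eq add.commute norm_triangle_ineq diff_add_eq)
        also have "norm (h *\<^sub>R V) \<le> c * h"
          using V(1) h(1) by (simp add: mult.commute)
        finally show ?thesis
          using Y(1) by simp
      qed
      moreover have "c * \<tau> + c * h \<le> c"
        using mult_left_mono[OF h(3) c] by (simp add: distrib_left)
      ultimately have "(\<tau> + h, Y + h *\<^sub>R V) \<in> P"
        using h \<tau> by (auto simp: P_def distrib_left dist_norm norm_minus_commute)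
      then show "\<exists>t'\<in>fst ` P. \<tau> < t' \<and> t' \<le> 1"
        using h by force
    qed simp
    then show ?thesis
      by (auto simp: P_def dist_norm norm_minus_commute)
  qed
  have "continuous_on (cball Y0 c) (\<lambda>Y. norm (E (1, Y)))"
    by (intro continuous_on_norm continuous_on_compose2[OF cont_E] continuous_intros) auto
  then obtain Y where Y: "Y \<in> cball Y0 c" "\<And>Y'. Y' \<in> cball Y0 c \<Longrightarrow> norm (E (1, Y)) \<le> norm (E (1, Y'))"
    using continuous_attains_inf[of "cball Y0 c" "\<lambda>Y. norm (E (1, Y))"] c by auto
  have "norm (E (1, Y)) \<le> \<eta>" if "\<eta> > 0" for \<eta>
    using approx[OF that] Y(2) by (force simp: dist_norm norm_minus_commute)
  then have "E (1, Y) = 0"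
    by (metis field_lbound_gt_zero less_le_not_le norm_eq_zero norm_le_zero_iff not_le zero_less_norm_iff dense)
  then have "matrix_exp X ** (matrix_exp (- X) ** F Y) = matrix_exp X ** F Y0"
    by (simp add: E_def)
  then have "F Y = matrix_exp X ** F Y0"
    by (simp add: matrix_mul_assoc)
  then show ?thesis
    using Y(1) by (auto simp: dist_norm norm_minus_commute)
qed

section \<open>The group of a matrix Lie algebra\<close>

lemma matrix_inv_right [simp]: "invertible A \<Longrightarrow> A ** matrix_inv A = mat 1"
  and matrix_inv_left [simp]: "invertible A \<Longrightarrow> matrix_inv A ** A = mat 1"
  unfolding invertible_def matrix_inv_def by (metis (mono_tags, lifting) someI_ex)+

lemma inverse_unique_mat:
  fixes A :: "complex^'n^'n"
  assumes "A ** B = mat 1" "B ** A = mat 1"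
  shows "invertible A" "matrix_inv A = B"
proof -
  show "invertible A"
    using assms invertible_def by blast
  then have "matrix_inv A ** A = mat 1"
    by simp
  then show "matrix_inv A = B"
    by (metis assms(1) matrix_mul_assoc matrix_mul_lid matrix_mul_rid)
qed

lemma matrix_inv_one [simp]: "matrix_inv (mat 1 :: complex^'n^'n) = mat 1"
  by (rule inverse_unique_mat) simp_all

lemma matrix_inv_mult:
  fixes A B :: "complex^'n^'n"
  assumes "invertible A" "invertible B"
  shows "matrix_inv (A ** B) = matrix_inv B ** matrix_inv A"
proof (rule inverse_unique_mat)
  have "A ** B ** (matrix_inv B ** matrix_inv A) = A ** (B ** matrix_inv B) ** matrix_inv A"
    by (simp add: matrix_mul_assoc)
  then show "A ** B ** (matrix_inv B ** matrix_inv A) = mat 1"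
    by (simp add: assms)
  have "matrix_inv B ** matrix_inv A ** (A ** B) = matrix_inv B ** (matrix_inv A ** A) ** B"
    by (simp add: matrix_mul_assoc)
  then show "matrix_inv B ** matrix_inv A ** (A ** B) = mat 1"
    by (simp add: assms)
qed

lemma matrix_inv_exp [simp]: "matrix_inv (matrix_exp A) = matrix_exp (- A)"
  by (rule inverse_unique_mat) simp_all

lemma invertible_matrix_exp [simp]: "invertible (matrix_exp A)"
  by (rule inverse_unique_mat[of _ "matrix_exp (- A)"]) simp_all

text \<open>
  The balls \<open>{U. near_one L \<rho> U}\<close> are the neighbourhoods of the identity in the intrinsic topology
  of \<open>lie_group_of L\<close>.
\<close>

inductive near_one :: "(complex^'n^'n) set \<Rightarrow> real \<Rightarrow> complex^'n^'n \<Rightarrow> bool"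
  for L :: "(complex^'n^'n) set" where
  one: "0 \<le> \<rho> \<Longrightarrow> near_one L \<rho> (mat 1)"
| mult: "A \<in> L \<Longrightarrow> near_one L \<rho> U \<Longrightarrow> near_one L (norm A + \<rho>) (matrix_exp A ** U)"

lemma near_one_exp: "A \<in> L \<Longrightarrow> norm A \<le> \<rho> \<Longrightarrow> near_one L \<rho> (matrix_exp A)"
  using near_one.mult[OF _ near_one.one[of "\<rho> - norm A"], of A L] by simp

lemma near_one_mult: "near_one L \<rho> U \<Longrightarrow> near_one L \<sigma> V \<Longrightarrow> near_one L (\<rho> + \<sigma>) (U ** V)"
proof (induction rule: near_one.induct)
  case (one \<rho>)
  \<comment> \<open>Monotonicity in the radius: the slack \<open>\<rho>\<close> of the trivial left
    factor has to be pushed to the end of the derivation of \<open>V\<close>.\<close>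
  have "near_one L \<tau> V \<Longrightarrow> near_one L (\<rho> + \<tau>) V" for \<tau> V
  proof (induction rule: near_one.induct)
    case (mult A \<tau> U)
    then show ?case
      using near_one.mult[of A L "\<rho> + \<tau>" U] by (simp add: algebra_simps)
  qed (simp add: near_one.one one)
  then show ?case
    using one by simp
next
  case (mult A \<rho> U)
  then show ?case
    using near_one.mult[of A L "\<rho> + \<sigma>" "U ** V"] by (simp add: algebra_simps matrix_mul_assoc)
qed

lemma near_one_mono: "near_one L \<rho> U \<Longrightarrow> \<rho> \<le> \<sigma> \<Longrightarrow> near_one L \<sigma> U"
  using near_one_mult[OF near_one.one[of "\<sigma> - \<rho>"], of L \<rho> U] by simp

locale matrix_lie_algebra =
  fixes L :: "(complex^'n^'n) set"
  assumes lie: "lie_subalgebra L"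
begin

abbreviation G where "G \<equiv> lie_group_of L"

lemma subspace: "subspace L"
  using lie by (simp add: lie_subalgebra_def)

lemma G_exp: "A \<in> L \<Longrightarrow> matrix_exp A \<in> G"
  using lie_group_of.mult[OF _ lie_group_of.one, of A L] by simp

lemma G_mult: "U \<in> G \<Longrightarrow> V \<in> G \<Longrightarrow> U ** V \<in> G"
  by (induction rule: lie_group_of.induct) (auto intro: lie_group_of.mult simp flip: matrix_mul_assoc)

lemma G_inverse: "U \<in> G \<Longrightarrow> invertible U \<and> matrix_inv U \<in> G"
proof (induction rule: lie_group_of.induct)
  case one
  then show ?case
    by (simp add: lie_group_of.one invertible_def exI[of _ "mat 1"])
next
  case (mult A U)
  then show ?case
    by (simp add: matrix_inv_mult invertible_mult G_mult G_exp subspace_neg[OF subspace])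
qed

lemma invertible_G [simp]: "U \<in> G \<Longrightarrow> invertible U"
  and inv_in_G [simp]: "U \<in> G \<Longrightarrow> matrix_inv U \<in> G"
  using G_inverse by blast+

lemma Ad_in_L: "U \<in> G \<Longrightarrow> X \<in> L \<Longrightarrow> U ** X ** matrix_inv U \<in> L"
proof (induction arbitrary: X rule: lie_group_of.induct)
  case one
  then show ?case
    by simp
next
  case (mult A U)
  have "matrix_exp A ** (U ** X ** matrix_inv U) ** matrix_exp (- A) \<in> L"
    using mult by (intro matrix_exp_Ad_in_lie_subalgebra lie)
  then show ?case
    using mult by (simp add: matrix_inv_mult matrix_mul_assoc)
qed

lemma near_one_in_G: "near_one L \<rho> U \<Longrightarrow> U \<in> G"
  by (induction rule: near_one.induct) (auto intro: lie_group_of.intros)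

lemma near_one_inverse: "near_one L \<rho> U \<Longrightarrow> near_one L \<rho> (matrix_inv U)"
proof (induction rule: near_one.induct)
  case (one \<rho>)
  then show ?case
    by (simp add: near_one.one)
next
  case (mult A \<rho> U)
  have "near_one L (\<rho> + norm A) (matrix_inv U ** matrix_exp (- A))"
    using mult by (intro near_one_mult near_one_exp) (auto simp: subspace_neg[OF subspace])
  then show ?case
    using mult near_one_in_G by (simp add: matrix_inv_mult add.commute)
qed

text \<open>Dividing every factor \<open>exp A\<close> into small steps, any \<open>near_one\<close> ball generates the group.\<close>

lemma G_generated_by_near_one:
  assumes "\<rho> > 0" and one: "mat 1 \<in> S" and S: "\<And>U V. near_one L \<rho> U \<Longrightarrow> V \<in> S \<Longrightarrow> U ** V \<in> S"
  shows "G \<subseteq> S"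
proof
  fix U assume "U \<in> G"
  then show "U \<in> S"
  proof (induction rule: lie_group_of.induct)
    case (mult A U)
    obtain n :: nat where n: "norm A / \<rho> < n"
      using reals_Archimedean2 by blast
    have n0: "n > 0"
      using n \<open>\<rho> > 0\<close> by (metis divide_nonneg_pos gr0I norm_ge_zero not_less of_nat_0)
    define B where "B = (1 / n) *\<^sub>R A"
    have "norm B \<le> \<rho>"
      using n n0 \<open>\<rho> > 0\<close> by (simp add: B_def field_simps)
    then have B: "near_one L \<rho> (matrix_exp B)"
      using mult(1) by (auto simp: B_def intro: near_one_exp subspace_scale[OF subspace])
    have "matrix_exp (real k *\<^sub>R B) ** U \<in> S" for k
    proof (induction k)
      case (Suc k)
      have "matrix_exp (real (Suc k) *\<^sub>R B) ** U = matrix_exp B ** (matrix_exp (real k *\<^sub>R B) ** U)"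
        using matrix_exp_add_scaleR[of 1 "real k" B] by (simp add: matrix_mul_assoc)
      then show ?case
        using S[OF B Suc] by simp
    qed (use mult in simp)
    from this[of n] show ?case
      using n0 by (simp add: B_def)
  qed (rule one)
qed

end

section \<open>Charts of the second kind\<close>

text \<open>Closeness to the identity gives \<open>norm V \<le> 2 * norm (A V)\<close>, so
  \<open>A\<close> is injective and, in finite dimension, surjective.\<close>

lemma near_identity_surj:
  fixes A :: "'a::euclidean_space \<Rightarrow> 'a"
  assumes "linear A" and close: "\<And>V. norm (A V - V) \<le> norm V / 2"
  shows "\<exists>V. A V = X \<and> norm V \<le> 2 * norm X"
proof -
  have bound: "norm V \<le> 2 * norm (A V)" for V
    using close[of V] norm_triangle_ineq2[of V "A V"] by (simp add: norm_minus_commute)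
  have "inj A"
    unfolding linear_injective_0[OF \<open>linear A\<close>] using bound by (metis mult_zero_right norm_le_zero_iff norm_zero)
  then have "surj A"
    by (rule linear_inj_imp_surj[OF \<open>linear A\<close>])
  then show ?thesis
    using bound by (metis surjD)
qed

context matrix_lie_algebra
begin

text \<open>This plays the part of the inverse function theorem. The factors of \<open>U\<close> are
  lifted one by one; each \<open>matrix_exp A\<close> costs a displacement of at most
  \<open>2 * norm A\<close>, so the length bound in \<open>near_one\<close> keeps the whole lift in
  the ball where \<open>M Y V = X\<close> is solvable for \<open>X \<in> L\<close>.\<close>

lemma lift_near_one:
  fixes F :: "complex^'n^'n \<Rightarrow> complex^'n^'n"
  assumes lin: "\<And>Y. linear (M Y)" and range: "\<And>Y V. M Y V \<in> L" and id: "\<And>V. V \<in> L \<Longrightarrow> M 0 V = V"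
    and cont: "\<And>V. isCont (\<lambda>Y. M Y V) 0"
    and der: "\<And>Y. (F has_derivative (\<lambda>V. M Y V ** F Y)) (at Y)"
    and "\<epsilon> > 0"
  shows "\<exists>\<rho>>0. \<forall>U. near_one L \<rho> U \<longrightarrow> (\<exists>Y. norm Y \<le> \<epsilon> \<and> F Y = U ** F 0)"
proof -
  \<comment> \<open>Continuity is given for each fixed vector only; summing over a basis turns it
    into a bound on the operator \<open>M Y - M 0\<close>.\<close>
  define K where "K Y = (\<Sum>b\<in>Basis. norm (M Y b - M 0 b))" for Y
  have "isCont K 0"
    unfolding K_def by (intro continuous_intros cont)
  then obtain r where "r > 0" and "\<forall>Y. dist Y 0 < r \<longrightarrow> dist (K Y) (K 0) < 1 / 2"
    unfolding continuous_at_eps_delta using half_gt_zero zero_less_one by blast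
  moreover have "K 0 = 0"
    by (simp add: K_def)
  ultimately have "\<bar>K Y\<bar> < 1 / 2" if "norm Y < r" for Y
    using that by (simp add: dist_real_def)
  then have r: "K Y < 1 / 2" if "norm Y < r" for Y
    using that abs_le_D1 order_le_less_trans by blast
  have diff: "norm (M Y V - M 0 V) \<le> K Y * norm V" for Y V
  proof -
    have "M Y V - M 0 V = (\<Sum>b\<in>Basis. (V \<bullet> b) *\<^sub>R (M Y b - M 0 b))"
    proof -
      have "M Z V = (\<Sum>b\<in>Basis. (V \<bullet> b) *\<^sub>R M Z b)" for Z
        by (subst euclidean_representation[of V, symmetric])
          (simp only: linear_sum[OF lin] linear_scale[OF lin])
      then show ?thesis
        by (simp only: scaleR_diff_right sum_subtractf)
    qed
    also have "norm \<dots> \<le> (\<Sum>b\<in>Basis. norm V * norm (M Y b - M 0 b))"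
      by (intro sum_norm_le) (auto intro!: mult_right_mono simp: Basis_le_norm)
    finally show ?thesis
      by (simp add: K_def sum_distrib_left mult.commute)
  qed
  have solvable: "\<exists>V. norm V \<le> 2 * norm X \<and> M Y V = X" if "norm Y < r" "X \<in> L" for X Y
  proof -
    \<comment> \<open>\<open>M 0\<close> is only a projection onto \<open>L\<close>. Adding the
      complementary projection \<open>V - M 0 V\<close> gives an operator close to the identity of
      the whole space. For \<open>X \<in> L\<close> the added term of the solution lies in
      \<open>L\<close> and is killed by \<open>M 0\<close>, hence it vanishes.\<close>
    have "norm (V - M 0 V + M Y V - V) \<le> norm V / 2" for V
      using diff[of Y V] mult_right_mono[OF less_imp_le[OF r[OF \<open>norm Y < r\<close>]], of "norm V"]
      by (simp add: algebra_simps)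
    moreover have "linear (\<lambda>V. V - M 0 V + M Y V)"
      by (intro linear_compose_add linear_compose_sub lin linear_id[unfolded id_def])
    ultimately obtain V where V: "V - M 0 V + M Y V = X" "norm V \<le> 2 * norm X"
      using near_identity_surj by blast
    have "V - M 0 V = X - M Y V"
      using V(1) by (simp add: algebra_simps)
    then have "V - M 0 V \<in> L"
      using subspace_diff[OF subspace \<open>X \<in> L\<close> range[of Y V]] by simp
    then have "V - M 0 V = M 0 (V - M 0 V)"
      by (simp add: id)
    also have "\<dots> = 0"
      by (simp add: linear_diff[OF lin] id range)
    finally show ?thesis
      using V by auto
  qed
  define s where "s = min \<epsilon> (r / 2)"
  have "s > 0"
    using \<open>\<epsilon> > 0\<close> \<open>r > 0\<close> by (simp add: s_def)
  have lift: "\<exists>Y. norm Y \<le> 2 * \<rho> \<and> F Y = U ** F 0" if "near_one L \<rho> U" "2 * \<rho> \<le> s" for \<rho> U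
    using that
  proof (induction rule: near_one.induct)
    case (one \<rho>)
    then show ?case
      by (intro exI[of _ 0]) simp
  next
    case (mult A \<rho> U)
    have "2 * \<rho> \<le> s"
      using mult.prems by (rule order_trans[rotated]) simp
    then obtain Y0 where Y0: "norm Y0 \<le> 2 * \<rho>" "F Y0 = U ** F 0"
      using mult.IH by auto
    have "\<exists>Y. norm (Y - Y0) \<le> 2 * norm A \<and> F Y = matrix_exp A ** F Y0"
    proof (rule lift_matrix_exp[where r = s])
      show "\<exists>V. norm V \<le> 2 * norm A \<and> M Y V = A" if "norm Y \<le> s" for Y
        using that \<open>r > 0\<close> by (intro solvable mult) (auto simp: s_def)
    qed (use der Y0 mult.prems in auto)
    then obtain Y where Y: "norm (Y - Y0) \<le> 2 * norm A" "F Y = matrix_exp A ** F Y0"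
      by blast
    have "norm Y \<le> 2 * (norm A + \<rho>)"
      using norm_triangle_sub[of Y Y0] Y Y0 by simp
    then show ?case
      using Y Y0 by (auto simp: matrix_mul_assoc)
  qed
  show ?thesis
  proof (intro exI[of _ "s / 2"] conjI allI impI)
    fix U assume "near_one L (s / 2) U"
    then show "\<exists>Y. norm Y \<le> \<epsilon> \<and> F Y = U ** F 0"
      using lift[of "s / 2" U] by (auto simp: s_def)
  qed (use \<open>s > 0\<close> in simp)
qed

end

section \<open>Words of exponentials as charts\<close>

text \<open>The fixed elements \<open>g\<close> between the exponentials make conjugates of the
  generators available as tangent directions; charts at the identity use \<open>g = mat 1\<close>. A
  word stops where the shorter of the two lists ends.\<close>

fun word :: "((complex^'n^'n) \<times> (complex^'n^'n)) list \<Rightarrow> real list \<Rightarrow> complex^'n^'n" where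
  "word ((C, g) # l) (t # ts) = matrix_exp (t *\<^sub>R C) ** g ** word l ts"
| "word _ _ = mat 1"

text \<open>The derivative of \<open>word l\<close> at \<open>ts\<close> in direction \<open>as\<close> is \<open>frame l ts as ** word l ts\<close>.\<close>

fun frame :: "((complex^'n^'n) \<times> (complex^'n^'n)) list \<Rightarrow> real list \<Rightarrow> real list \<Rightarrow> complex^'n^'n" where
  "frame ((C, g) # l) (t # ts) (a # as) =
     a *\<^sub>R C + matrix_exp (t *\<^sub>R C) ** (g ** frame l ts as ** matrix_inv g) ** matrix_exp (- (t *\<^sub>R C))"
| "frame _ _ _ = 0"

text \<open>The partial derivatives of \<open>word l\<close> at times zero, translated to the
  identity: each generator is conjugated by the product of the elements \<open>g\<close> standing
  before it.\<close>

fun frame_vectors :: "((complex^'n^'n) \<times> (complex^'n^'n)) list \<Rightarrow> (complex^'n^'n) list" where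
  "frame_vectors ((C, g) # l) = C # map (\<lambda>X. g ** X ** matrix_inv g) (frame_vectors l)"
| "frame_vectors [] = []"

lemma length_frame_vectors [simp]: "length (frame_vectors l) = length l"
  by (induction l rule: frame_vectors.induct) auto

lemma has_derivative_matrix_exp_linear:
  assumes "linear c"
  shows "((\<lambda>Y. matrix_exp (c Y *\<^sub>R A)) has_derivative (\<lambda>V. c V *\<^sub>R (A ** matrix_exp (c Y *\<^sub>R A)))) (at (Y :: 'a::euclidean_space))"
proof -
  have "(c has_derivative c) (at Y)"
    using assms by (simp add: bounded_linear_imp_has_derivative linear_conv_bounded_linear)
  moreover have "((\<lambda>t. matrix_exp (t *\<^sub>R A)) has_derivative (\<lambda>h. h *\<^sub>R (A ** matrix_exp (c Y *\<^sub>R A)))) (at (c Y))"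
    using matrix_exp_has_vector_derivative[of A "c Y" UNIV] by (simp add: has_vector_derivative_def)
  ultimately show ?thesis
    using diff_chain_at[of c c Y "\<lambda>t. matrix_exp (t *\<^sub>R A)"] by (simp add: o_def)
qed

text \<open>The times are linear functionals of a point \<open>Y\<close>, so that a word becomes a
  map on a Euclidean space through which paths can be lifted. The formula is the product rule, with
  the inverses in \<open>frame\<close> cancelling against the word on their right.\<close>

lemma word_has_derivative:
  fixes Y :: "'a::euclidean_space"
  assumes "length cs = length l" "\<forall>c\<in>set cs. linear c" "\<forall>(C, g)\<in>set l. invertible g"
  shows "((\<lambda>Y. word l (map (\<lambda>c. c Y) cs)) has_derivative
    (\<lambda>V. frame l (map (\<lambda>c. c Y) cs) (map (\<lambda>c. c V) cs) ** word l (map (\<lambda>c. c Y) cs))) (at Y)"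
  using assms
proof (induction l cs rule: list_induct2')
  case (4 x l c cs)
  obtain C g where x: "x = (C, g)"
    by force
  let ?w = "\<lambda>Y. word l (map (\<lambda>c. c Y) cs)" and ?e = "matrix_exp (c Y *\<^sub>R C)"
  let ?f = "\<lambda>V. frame l (map (\<lambda>c. c Y) cs) (map (\<lambda>c. c V) cs)"
  have "((\<lambda>Y. (matrix_exp (c Y *\<^sub>R C) ** g) ** ?w Y) has_derivative
      (\<lambda>V. (?e ** g) ** (?f V ** ?w Y) + (?e ** 0 + (c V *\<^sub>R (C ** ?e)) ** g) ** ?w Y)) (at Y)"
    using 4 by (intro mm.FDERIV has_derivative_matrix_exp_linear has_derivative_const) auto
  moreover have "(?e ** g) ** (?f V ** ?w Y) + (?e ** 0 + (c V *\<^sub>R (C ** ?e)) ** g) ** ?w Y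
      = frame (x # l) (map (\<lambda>c. c Y) (c # cs)) (map (\<lambda>c. c V) (c # cs)) ** word (x # l) (map (\<lambda>c. c Y) (c # cs))" for V
  proof -
    have "?e ** (g ** ?f V ** matrix_inv g) ** matrix_exp (- (c Y *\<^sub>R C)) ** (?e ** g ** ?w Y)
       = ?e ** (g ** ?f V ** (matrix_inv g ** (matrix_exp (- (c Y *\<^sub>R C)) ** ?e) ** g)) ** ?w Y"
      by (simp only: matrix_mul_assoc)
    also have "\<dots> = (?e ** g) ** (?f V ** ?w Y)"
      using 4 by (simp add: x) (simp add: matrix_mul_assoc)
    finally show ?thesis
      by (simp add: x mm.add_left mm.scaleR_left matrix_mul_assoc)
  qed
  ultimately show ?case
    by (simp add: x)
qed auto

lemma frame_linear:
  assumes "length cs = length l" "\<forall>c\<in>set cs. linear c"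
  shows "linear (\<lambda>V. frame l ts (map (\<lambda>c. c V) cs))"
  using assms
proof (induction l cs arbitrary: ts rule: list_induct2')
  case (4 x l c cs)
  obtain C g where x: "x = (C, g)"
    by force
  show ?case
  proof (cases ts)
    case (Cons t ts')
    have lin: "linear (\<lambda>V. frame l ts' (map (\<lambda>c. c V) cs))" "linear c"
      using 4 by auto
    show ?thesis
      unfolding Cons x
      by (rule linearI)
        (simp_all add: linear_add[OF lin(1)] linear_add[OF lin(2)] linear_scale[OF lin(1)] linear_scale[OF lin(2)]
          mm.add_left mm.add_right mm.scaleR_left mm.scaleR_right scaleR_add_left scaleR_add_right)
  qed (simp add: linear_zero)
qed (auto simp: linear_zero)

lemma frame_isCont:
  fixes cs :: "('a::euclidean_space \<Rightarrow> real) list"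
  assumes "length cs = length l" "\<forall>c\<in>set cs. linear c"
  shows "isCont (\<lambda>Y. frame l (map (\<lambda>c. c Y) cs) as) Y"
  using assms
proof (induction l cs arbitrary: "as" rule: list_induct2')
  case (4 x l c cs)
  obtain C g where x: "x = (C, g)"
    by force
  show ?case
  proof (cases "as")
    case (Cons a as')
    have "isCont (\<lambda>Y. matrix_exp (c Y *\<^sub>R A)) Y" for A :: "complex^'b^'b"
      using 4 has_derivative_matrix_exp_linear by (intro has_derivative_continuous) auto
    from this[of C] this[of "- C"] show ?thesis
      unfolding Cons x using 4
      by (auto intro!: continuous_intros mm.continuous)
  qed simp
qed auto

lemma frame_0:
  "length as = length l \<Longrightarrow> frame l (map (\<lambda>_. 0) l) as = sum_list (map2 (*\<^sub>R) as (frame_vectors l))"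
proof (induction l "as" rule: list_induct2')
  case (4 x l a "as")
  obtain C g where x: "x = (C, g)"
    by force
  have "g ** sum_list xs ** h = sum_list (map (\<lambda>X. g ** X ** h) xs)" for g h :: "complex^'a^'a" and xs
    by (induction xs) (simp_all add: mm.add_left mm.add_right)
  then show ?case
    using 4 by (simp add: x zip_map2 o_def mm.scaleR_left mm.scaleR_right case_prod_beta)
qed auto

context matrix_lie_algebra
begin

lemma frame_in_L:
  assumes "\<forall>(C, g)\<in>set l. C \<in> L \<and> g \<in> G"
  shows "frame l ts as \<in> L"
  using assms
proof (induction l ts "as" rule: frame.induct)
  case (1 C g l t ts a "as")
  then have "g ** frame l ts as ** matrix_inv g \<in> L" "t *\<^sub>R C \<in> L"
    by (auto intro: Ad_in_L subspace_scale[OF subspace])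
  then show ?case
    using 1 by (auto intro!: subspace_add[OF subspace] subspace_scale[OF subspace] matrix_exp_Ad_in_lie_subalgebra lie)
qed (use subspace_0[OF subspace] in auto)

text \<open>The functionals \<open>cs\<close> are dual to the frame vectors and extended to all
  matrices. With these coordinates the translated derivative at times zero is the identity on
  \<open>L\<close>, as \<open>lift_near_one\<close> requires.\<close>

lemma word_covers_near_one:
  assumes l: "\<forall>(C, g)\<in>set l. C \<in> L \<and> g \<in> G"
    and basis: "distinct (frame_vectors l)" "independent (set (frame_vectors l))"
      "L \<subseteq> span (set (frame_vectors l))"
  shows "\<exists>cs. length cs = length l \<and> (\<forall>c\<in>set cs. linear (c :: complex^'n^'n \<Rightarrow> real)) \<and>
    (\<forall>\<epsilon>>0. \<exists>\<rho>>0. \<forall>U. near_one L \<rho> U \<longrightarrow>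
      (\<exists>Y. norm Y \<le> \<epsilon> \<and> word l (map (\<lambda>c. c Y) cs) = U ** word l (map (\<lambda>_. 0) l)))"
proof -
  let ?B = "set (frame_vectors l)"
  have "\<exists>c. linear c \<and> (\<forall>w\<in>?B. c w = (if w = v then 1 else 0 :: real))" for v
    by (rule linear_independent_extend[OF basis(2)])
  then have "\<exists>dual. \<forall>v. linear (dual v :: _ \<Rightarrow> real) \<and> (\<forall>w\<in>?B. dual v w = (if w = v then 1 else 0))"
    by (intro choice allI)
  then obtain dual where
      *: "\<forall>v. linear (dual v :: _ \<Rightarrow> real) \<and> (\<forall>w\<in>?B. dual v w = (if w = v then 1 else 0))" ..
  then have dual: "linear (dual v)" "w \<in> ?B \<Longrightarrow> dual v w = (if w = v then 1 else 0)" for v w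
    by simp_all
  define cs where "cs = map dual (frame_vectors l)"
  have cs: "length cs = length l" "\<forall>c\<in>set cs. linear c"
    by (auto simp: cs_def dual)
  define M where "M Y V = frame l (map (\<lambda>c. c Y) cs) (map (\<lambda>c. c V) cs)" for Y V
  have zero: "map (\<lambda>c. c 0) cs = map (\<lambda>_. 0) l"
    by (rule nth_equalityI) (auto simp: cs_def linear_0[OF dual(1)])
  have M0: "M 0 V = (\<Sum>v\<in>?B. dual v V *\<^sub>R v)" for V
  proof -
    have "M 0 V = sum_list (map2 (*\<^sub>R) (map (\<lambda>c. c V) cs) (frame_vectors l))"
      unfolding M_def zero using cs by (simp add: frame_0)
    also have "\<dots> = sum_list (map (\<lambda>v. dual v V *\<^sub>R v) (frame_vectors l))"
      by (simp add: cs_def zip_map1 zip_same_conv_map o_def)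
    finally show ?thesis
      using basis(1) by (simp add: sum_list_distinct_conv_sum_set)
  qed
  have linM: "linear (M Y)" for Y
    unfolding M_def using cs by (rule frame_linear)
  have id: "M 0 V = V" if "V \<in> L" for V
  proof -
    have "M 0 v = v" if "v \<in> ?B" for v
      using that unfolding M0 by (simp add: dual(2)[OF that] if_distrib[of "\<lambda>x. x *\<^sub>R _"] cong: if_cong)
    then show ?thesis
      using linear_eq_on[OF linM linear_id, of V ?B 0] basis(3) that by auto
  qed
  have inv: "\<forall>(C, g)\<in>set l. invertible g"
    using l by auto
  have "\<exists>\<rho>>0. \<forall>U. near_one L \<rho> U \<longrightarrow> (\<exists>Y. norm Y \<le> \<epsilon> \<and>
      word l (map (\<lambda>c. c Y) cs) = U ** word l (map (\<lambda>c. c 0) cs))" if "\<epsilon> > 0" for \<epsilon>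
  proof (rule lift_near_one[of M])
    show "isCont (\<lambda>Y. M Y V) 0" for V
      unfolding M_def using cs by (rule frame_isCont)
    show "M Y V \<in> L" for Y V
      unfolding M_def using l by (rule frame_in_L)
    show "((\<lambda>Y. word l (map (\<lambda>c. c Y) cs)) has_derivative (\<lambda>V. M Y V ** word l (map (\<lambda>c. c Y) cs))) (at Y)" for Y
      unfolding M_def using cs inv by (rule word_has_derivative)
  qed (use linM id that in auto)
  then show ?thesis
    using cs unfolding zero by blast
qed

end

section \<open>Compact groups: the intrinsic topology\<close>

lemma frame_vectors_trivial [simp]: "frame_vectors (map (\<lambda>X. (X, mat 1)) Xs) = Xs"
  by (induction Xs) auto

lemma linear_list_bound:
  fixes cs :: "('a::euclidean_space \<Rightarrow> real) list"
  assumes "\<forall>c\<in>set cs. linear c"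
  shows "\<exists>K>0. \<forall>c\<in>set cs. \<forall>Y. \<bar>c Y\<bar> \<le> K * norm Y"
  using assms
proof (induction cs)
  case (Cons c cs)
  then obtain K where K: "K > 0" "\<forall>c\<in>set cs. \<forall>Y. \<bar>c Y\<bar> \<le> K * norm Y"
    by auto
  obtain K' where K': "K' > 0" "\<forall>Y. norm (c Y) \<le> K' * norm Y"
    using Cons.prems linear_bounded_pos[of c] by auto
  have "\<bar>f Y\<bar> \<le> max K K' * norm Y"
    if "\<bar>f Y\<bar> \<le> K * norm Y \<or> \<bar>f Y\<bar> \<le> K' * norm Y" for f and Y :: "'a"
    using that mult_right_mono[of K "max K K'" "norm Y"] mult_right_mono[of K' "max K K'" "norm Y"]
    by auto
  then show ?case
    using K K' by (intro exI[of _ "max K K'"]) (auto simp: less_max_iff_disj)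
qed (auto intro: exI[of _ 1])

lemma word_zero_trivial [simp]: "word (map (\<lambda>X. (X, mat 1)) Xs) (map (\<lambda>_. 0) Xs) = mat 1"
  by (induction Xs) auto

context matrix_lie_algebra
begin

lemma word_near_one:
  fixes R \<epsilon> :: real
  assumes "\<forall>X\<in>set Xs. X \<in> L \<and> norm X \<le> R" "\<forall>t\<in>set ts. \<bar>t\<bar> \<le> \<epsilon>" "0 \<le> R" "0 \<le> \<epsilon>"
  shows "near_one L (length Xs * (\<epsilon> * R)) (word (map (\<lambda>X. (X, mat 1)) Xs) ts)"
  using assms(1,2)
proof (induction Xs ts rule: list_induct2')
  case (4 X Xs t ts)
  have "norm (t *\<^sub>R X) \<le> \<epsilon> * R"
    using 4 assms(3,4) by (auto intro!: mult_mono)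
  then have "near_one L (\<epsilon> * R) (matrix_exp (t *\<^sub>R X))"
    using 4 by (intro near_one_exp) (auto intro: subspace_scale[OF subspace])
  from near_one_mult[OF this 4(1)] 4 show ?case
    by (simp add: algebra_simps)
qed (use assms(3,4) in \<open>auto intro!: near_one.one\<close>)

end

locale compact_matrix_lie_group = matrix_lie_algebra L for L :: "(complex^'n^'n) set" +
  assumes compact_G: "compact (lie_group_of L)"
begin

lemma mult_bound: "\<exists>K>0. \<forall>U\<in>G. \<forall>X :: complex^'n^'n. norm (U ** X) \<le> K * norm X \<and> norm (X ** U) \<le> K * norm X"
proof -
  obtain B where B: "B > 0" "\<forall>U\<in>G. norm U \<le> B"
    using compact_imp_bounded[OF compact_G] bounded_pos by blast
  obtain K where K: "K > 0" "\<forall>(X :: complex^'n^'n) (Y :: complex^'n^'n). norm (X ** Y) \<le> norm X * norm Y * K"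
    using mm.pos_bounded by blast
  have "norm (U ** X) \<le> (B * K) * norm X \<and> norm (X ** U) \<le> (B * K) * norm X" if "U \<in> G" for U X
  proof -
    have "norm (U ** X) \<le> norm U * norm X * K" "norm (X ** U) \<le> norm X * norm U * K"
      by - (rule K(2)[rule_format])+
    moreover have "norm U * norm X * K \<le> B * norm X * K"
      using B(2) K(1) that by (intro mult_right_mono) auto
    ultimately show ?thesis
      by (simp add: mult_ac)
  qed
  then show ?thesis
    using B K by (intro exI[of _ "B * K"]) auto
qed

text \<open>Conjugation turns a factor \<open>matrix_exp A\<close> into the exponential of
  \<open>U ** A ** matrix_inv U\<close>, whose norm is at most \<open>K * K\<close> times that of
  \<open>A\<close>. Boundedness of \<open>G\<close> makes \<open>K\<close> independent of
  \<open>U\<close>.\<close>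

lemma near_one_conj: "\<exists>\<kappa>>0. \<forall>U\<in>G. \<forall>\<rho> V. near_one L \<rho> V \<longrightarrow> near_one L (\<kappa> * \<rho>) (U ** V ** matrix_inv U)"
proof -
  obtain K where K: "K > 0" "\<forall>U\<in>G. \<forall>X :: complex^'n^'n. norm (U ** X) \<le> K * norm X \<and> norm (X ** U) \<le> K * norm X"
    using mult_bound by blast
  have "near_one L (K * K * \<rho>) (U ** V ** matrix_inv U)" if U: "U \<in> G" and "near_one L \<rho> V" for U V \<rho>
    using that(2)
  proof (induction rule: near_one.induct)
    case (one \<rho>)
    then show ?case
      using U K(1) by (simp add: near_one.one)
  next
    case (mult A \<rho> V)
    have "norm (U ** A ** matrix_inv U) \<le> K * norm (U ** A)"
      using K U by simp
    also have "\<dots> \<le> K * (K * norm A)"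
      using K U by (intro mult_left_mono) auto
    finally have "near_one L (K * K * norm A) (matrix_exp (U ** A ** matrix_inv U))"
      using mult U by (intro near_one_exp) (auto intro: Ad_in_L simp: mult.assoc)
    moreover have "matrix_exp (U ** A ** matrix_inv U) = U ** matrix_exp A ** matrix_inv U"
      using U by (intro matrix_exp_conj[symmetric]) simp_all
    ultimately have "near_one L (K * K * norm A + K * K * \<rho>)
        (U ** matrix_exp A ** matrix_inv U ** (U ** V ** matrix_inv U))"
      using mult by (simp add: near_one_mult)
    moreover have "U ** matrix_exp A ** matrix_inv U ** (U ** V ** matrix_inv U)
       = U ** matrix_exp A ** (matrix_inv U ** U) ** V ** matrix_inv U"
      by (simp only: matrix_mul_assoc)
    ultimately show ?case
      using U by (simp add: distrib_left matrix_mul_assoc)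
  qed
  then show ?thesis
    using K(1) by (intro exI[of _ "K * K"]) auto
qed

text \<open>
  Separability of the intrinsic topology: products of exponentials of rational multiples of the
  elements of a basis \<open>Xs\<close> are dense.
\<close>

lemma countable_dense:
  assumes Xs: "set Xs \<subseteq> L"
    and cover: "\<rho> > 0" "\<And>U. near_one L \<rho> U \<Longrightarrow> \<exists>ts. U = word (map (\<lambda>X. (X, mat 1)) Xs) ts"
  shows "\<exists>D. countable D \<and> D \<subseteq> G \<and> (\<forall>U\<in>G. \<forall>\<epsilon>>0. \<exists>q\<in>D. near_one L \<epsilon> (U ** matrix_inv q))"
proof -
  define D where "D = (\<lambda>ps. foldr (\<lambda>(r, X) U. matrix_exp (r *\<^sub>R X) ** U) ps (mat 1)) ` lists (\<rat> \<times> set Xs)"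
  have D1: "mat 1 \<in> D"
    unfolding D_def by (rule image_eqI[of _ _ "[]"]) auto
  have D_mult: "matrix_exp (r *\<^sub>R X) ** q \<in> D" if "r \<in> \<rat>" "X \<in> set Xs" "q \<in> D" for r X q
  proof -
    obtain ps where "ps \<in> lists (\<rat> \<times> set Xs)" "q = foldr (\<lambda>(r, X) U. matrix_exp (r *\<^sub>R X) ** U) ps (mat 1)"
      using \<open>q \<in> D\<close> by (auto simp: D_def)
    then show ?thesis
      unfolding D_def using that by (intro image_eqI[of _ _ "(r, X) # ps"]) auto
  qed
  have DG: "D \<subseteq> G"
  proof -
    have "foldr (\<lambda>(r, X) U. matrix_exp (r *\<^sub>R X) ** U) ps (mat 1) \<in> G" if "ps \<in> lists (\<rat> \<times> set Xs)" for ps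
      using that Xs
      by (induction ps) (auto intro!: lie_group_of.intros subspace_scale[OF subspace])
    then show ?thesis
      by (auto simp: D_def)
  qed
  define Q where "Q = {U. \<forall>\<epsilon>>0. \<exists>q\<in>D. near_one L \<epsilon> (U ** matrix_inv q)}"
  obtain \<kappa> where \<kappa>: "\<kappa> > 0" "\<And>U \<rho> V. U \<in> G \<Longrightarrow> near_one L \<rho> V \<Longrightarrow> near_one L (\<kappa> * \<rho>) (U ** V ** matrix_inv U)"
    using near_one_conj by blast
  have Q_exp: "matrix_exp (t *\<^sub>R X) ** U \<in> Q" if X: "X \<in> set Xs" and "U \<in> Q" for t X U
    unfolding Q_def
  proof (intro CollectI allI impI)
    fix \<epsilon> :: real assume "\<epsilon> > 0"
    \<comment> \<open>Half of \<open>\<epsilon>\<close> pays for replacing \<open>t\<close> by a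
      rational \<open>r\<close>, the other half for the error of \<open>q\<close>, which gets
      conjugated by \<open>matrix_exp (t *\<^sub>R X)\<close> and may grow by the factor
      \<open>\<kappa>\<close>.\<close>
    then have "\<epsilon> / 2 / \<kappa> > 0"
      using \<kappa>(1) by simp
    then obtain q where q: "q \<in> D" "near_one L (\<epsilon> / 2 / \<kappa>) (U ** matrix_inv q)"
      using \<open>U \<in> Q\<close> unfolding Q_def by blast
    have "X \<in> L" "q \<in> G"
      using X Xs q DG by auto
    have "t < t + \<epsilon> / 2 / (norm X + 1)"
      using \<open>\<epsilon> > 0\<close> by (simp add: add_nonneg_pos)
    then obtain r where r: "r \<in> \<rat>" "t < r" "r < t + \<epsilon> / 2 / (norm X + 1)"
      using Rats_dense_in_real by blast
    have "norm ((t - r) *\<^sub>R X) \<le> (\<epsilon> / 2 / (norm X + 1)) * (norm X + 1)"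
      using r unfolding norm_scaleR by (intro mult_mono) auto
    also have "\<dots> = \<epsilon> / 2"
      using norm_ge_zero[of X] by (intro nonzero_eq_divide_eq[THEN iffD1, OF _ refl]) linarith
    finally have "near_one L (\<epsilon> / 2) (matrix_exp ((t - r) *\<^sub>R X))"
      using \<open>X \<in> L\<close> by (intro near_one_exp subspace_scale[OF subspace])
    moreover have "near_one L (\<kappa> * (\<epsilon> / 2 / \<kappa>))
        (matrix_exp (t *\<^sub>R X) ** (U ** matrix_inv q) ** matrix_inv (matrix_exp (t *\<^sub>R X)))"
      using \<open>X \<in> L\<close> by (intro \<kappa>(2) q G_exp subspace_scale[OF subspace])
    ultimately have "near_one L (\<kappa> * (\<epsilon> / 2 / \<kappa>) + \<epsilon> / 2)
        (matrix_exp (t *\<^sub>R X) ** (U ** matrix_inv q) ** matrix_exp (- (t *\<^sub>R X)) ** matrix_exp ((t - r) *\<^sub>R X))"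
      by (simp add: near_one_mult)
    moreover have "matrix_exp (- (t *\<^sub>R X)) ** matrix_exp ((t - r) *\<^sub>R X) = matrix_exp (- (r *\<^sub>R X))"
      using matrix_exp_add_scaleR[of "- t" "t - r" X] by simp
    ultimately have "near_one L \<epsilon> (matrix_exp (t *\<^sub>R X) ** U ** (matrix_inv q ** matrix_exp (- (r *\<^sub>R X))))"
      using \<kappa>(1) by (simp flip: matrix_mul_assoc)
    moreover have "matrix_inv q ** matrix_exp (- (r *\<^sub>R X)) = matrix_inv (matrix_exp (r *\<^sub>R X) ** q)"
      using \<open>q \<in> G\<close> by (simp add: matrix_inv_mult)
    ultimately show "\<exists>q\<in>D. near_one L \<epsilon> (matrix_exp (t *\<^sub>R X) ** U ** matrix_inv q)"
      using D_mult[OF r(1) X q(1)] by (intro bexI) simp_all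
  qed
  have Q_word: "word (map (\<lambda>X. (X, mat 1)) Ys) ts ** U \<in> Q" if "set Ys \<subseteq> set Xs" "U \<in> Q" for Ys ts U
    using that by (induction Ys ts rule: list_induct2') (auto simp: Q_exp simp flip: matrix_mul_assoc)
  have "G \<subseteq> Q"
  proof (rule G_generated_by_near_one[OF cover(1)])
    show "mat 1 \<in> Q"
      using D1 by (auto simp: Q_def intro!: bexI[of _ "mat 1"] near_one.one)
    show "U ** V \<in> Q" if "near_one L \<rho> U" "V \<in> Q" for U V
      using cover(2)[OF that(1)] Q_word[OF order_refl that(2)] by auto
  qed
  moreover have "countable D"
    unfolding D_def by (intro countable_image countable_lists countable_SIGMA countable_rat countable_finite) auto
  ultimately show ?thesis
    using DG unfolding Q_def by blast
qed

text \<open>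
  On a compact \<open>G\<close> the intrinsic topology is the subspace topology: countably many translates of a
  compact chart cover \<open>G\<close>, so by Baire one of them has interior points.
\<close>

lemma near_one_of_norm:
  assumes "\<eta> > 0"
  shows "\<exists>\<delta>>0. \<forall>U\<in>G. norm (U - mat 1) < \<delta> \<longrightarrow> near_one L \<eta> U"
proof -
  obtain B where B: "B \<subseteq> L" "independent B" "L \<subseteq> span B"
    using basis_exists[of L] by metis
  then obtain Xs where Xs: "set Xs = B" "distinct Xs"
    using finite_distinct_list finiteI_independent by blast
  let ?l = "map (\<lambda>X. (X, mat 1 :: complex^'n^'n)) Xs"
  have l: "\<forall>(C, g)\<in>set ?l. C \<in> L \<and> g \<in> G"
    using B Xs by (auto intro: lie_group_of.one)
  have zero: "word ?l (map (\<lambda>_. 0) ?l) = mat 1"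
    using word_zero_trivial[of Xs] by (simp add: o_def)
  obtain cs where cs: "length cs = length Xs" "\<forall>c\<in>set cs. linear (c :: complex^'n^'n \<Rightarrow> real)"
    and covers: "\<And>\<epsilon>. \<epsilon> > 0 \<Longrightarrow> \<exists>\<rho>>0. \<forall>U. near_one L \<rho> U \<longrightarrow> (\<exists>Y. norm Y \<le> \<epsilon> \<and> word ?l (map (\<lambda>c. c Y) cs) = U)"
    using word_covers_near_one[OF l] Xs B unfolding zero by auto
  define F where "F Y = word ?l (map (\<lambda>c. c Y) cs)" for Y
  obtain R where R: "R > 0" "\<forall>X\<in>set Xs. norm X \<le> R"
    using finite_imp_bounded[of "set Xs"] bounded_pos by auto
  obtain K where K: "K > 0" "\<And>c Y. c \<in> set cs \<Longrightarrow> \<bar>c Y\<bar> \<le> K * norm Y"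
    using linear_list_bound[OF cs(2)] by blast
  \<comment> \<open>A word has \<open>length Xs\<close> factors, each of length at most
    \<open>K * \<epsilon> * R\<close>; the \<open>\<epsilon>\<close> chosen next makes their total
    at most \<open>\<eta> / 2\<close>. The added 1 keeps the denominator positive for empty
    \<open>Xs\<close>.\<close>
  define m where "m = real (length Xs) + 1"
  define \<epsilon> where "\<epsilon> = \<eta> / 2 / (K * R * m)"
  have "m > 0"
    by (simp add: m_def)
  then have "\<epsilon> > 0"
    using assms K R by (simp add: \<epsilon>_def)
  have F_near: "near_one L (\<eta> / 2) (F Y)" if "norm Y \<le> \<epsilon>" for Y
  proof -
    have "\<bar>c Y\<bar> \<le> K * \<epsilon>" if "c \<in> set cs" for c
      using K(2)[OF that, of Y] mult_left_mono[OF \<open>norm Y \<le> \<epsilon>\<close>, of K] K(1) by linarith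
    then have "near_one L (length Xs * (K * \<epsilon> * R)) (F Y)"
      unfolding F_def using B Xs R K \<open>\<epsilon> > 0\<close> by (intro word_near_one) auto
    moreover have "length Xs * (K * \<epsilon> * R) \<le> m * (K * \<epsilon> * R)"
      using K R \<open>\<epsilon> > 0\<close> by (intro mult_right_mono) (auto simp: m_def)
    moreover have "m * (K * \<epsilon> * R) = \<eta> / 2"
      using K R \<open>m > 0\<close> by (simp add: \<epsilon>_def)
    ultimately show ?thesis
      by (metis near_one_mono)
  qed
  obtain \<rho> where \<rho>: "\<rho> > 0" "\<And>U. near_one L \<rho> U \<Longrightarrow> \<exists>Y. norm Y \<le> \<epsilon> \<and> F Y = U"
    using covers[OF \<open>\<epsilon> > 0\<close>] unfolding F_def by blast
  obtain D where D: "countable D" "D \<subseteq> G" "\<And>U \<epsilon>. U \<in> G \<Longrightarrow> \<epsilon> > 0 \<Longrightarrow> \<exists>q\<in>D. near_one L \<epsilon> (U ** matrix_inv q)"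
    using countable_dense[of Xs, OF _ \<rho>(1)] B Xs \<rho>(2) unfolding F_def by (metis order_refl)
  define T :: "complex^'n^'n \<Rightarrow> (complex^'n^'n) set" where "T q = (\<lambda>Y. F Y ** q) ` cball 0 \<epsilon>" for q
  have "continuous_on UNIV F"
    unfolding F_def using cs l
    by (intro continuous_at_imp_continuous_on ballI has_derivative_continuous[OF word_has_derivative])
       auto
  then have "compact (T q)" for q
    unfolding T_def by (intro compact_continuous_image mm.continuous_on continuous_on_const)
      (auto intro: continuous_on_subset)
  then have open_diff: "openin (top_of_set G) (G - T q)" for q
    by (simp add: Diff_eq openin_open_Int compact_imp_closed open_Compl)
  \<comment> \<open>If every \<open>G - T q\<close> were dense, so would be their intersection. That
    intersection is empty: each \<open>U\<close> is intrinsically \<open>\<rho>\<close>-close to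
    some \<open>q\<close>, and then \<open>U ** matrix_inv q\<close> lies in the chart.\<close>
  have "\<exists>q\<in>D. \<not> G \<subseteq> closure (G - T q)"
  proof (rule ccontr)
    assume "\<not> ?thesis"
    then have "G \<subseteq> closure (\<Inter>((\<lambda>q. G - T q) ` D))"
      using D(1) open_diff compact_imp_closed[OF compact_G] by (intro Baire) auto
    moreover have "\<Inter>((\<lambda>q. G - T q) ` D) = {}"
    proof -
      have "\<exists>q\<in>D. U \<in> T q" if U: "U \<in> G" for U
      proof -
        obtain q where q: "q \<in> D" "near_one L \<rho> (U ** matrix_inv q)"
          using D(3)[OF U \<rho>(1)] by blast
        then obtain Y where Y: "norm Y \<le> \<epsilon>" "F Y = U ** matrix_inv q"
          using \<rho>(2) by blast
        have "F Y ** q = U ** (matrix_inv q ** q)"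
          unfolding Y(2) by (simp only: matrix_mul_assoc)
        also have "\<dots> = U"
          using q D(2) by (simp add: subset_iff)
        finally show ?thesis
          using Y q unfolding T_def by (intro bexI[of _ q] image_eqI[of _ _ Y]) auto
      qed
      moreover have "D \<noteq> {}"
        using D(3)[OF lie_group_of.one, of 1] by auto
      ultimately show ?thesis
        by blast
    qed
    ultimately show False
      using lie_group_of.one[of L] by auto
  qed
  then obtain q U0 where q: "q \<in> D" and U0: "U0 \<in> G" "U0 \<notin> closure (G - T q)"
    by blast
  then obtain d where d: "d > 0" "\<And>U. U \<in> G \<Longrightarrow> dist U U0 < d \<Longrightarrow> U \<in> T q"
    unfolding closure_approachable by blast
  have T_near: "near_one L (\<eta> / 2) (U ** matrix_inv q)" if "U \<in> T q" for U
  proof -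
    obtain Y where Y: "norm Y \<le> \<epsilon>" "U = F Y ** q"
      using \<open>U \<in> T q\<close> by (auto simp: T_def)
    have "U ** matrix_inv q = F Y ** (q ** matrix_inv q)"
      unfolding Y by (simp only: matrix_mul_assoc)
    also have "\<dots> = F Y"
      using q D(2) by (simp add: subset_iff)
    finally show "near_one L (\<eta> / 2) (U ** matrix_inv q)"
      using F_near Y by simp
  qed
  obtain B' where B': "B' > 0" "\<forall>U\<in>G. \<forall>X :: complex^'n^'n. norm (U ** X) \<le> B' * norm X \<and> norm (X ** U) \<le> B' * norm X"
    using mult_bound by blast
  \<comment> \<open>The interior point is moved to the identity by a quotient:
    \<open>U ** U0\<close> and \<open>U0\<close> both lie in \<open>T q\<close>, so after cancelling
    \<open>q\<close> the matrix \<open>U\<close> is a quotient of two elements of length at most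
    \<open>\<eta> / 2\<close>.\<close>
  have "near_one L \<eta> U" if U: "U \<in> G" "norm (U - mat 1) < d / B'" for U
  proof -
    have "dist (U ** U0) U0 = norm ((U - mat 1) ** U0)"
      by (simp add: dist_norm mm.diff_left)
    also have "\<dots> \<le> B' * norm (U - mat 1)"
      using B' U0 by blast
    also have "\<dots> < d"
      using U(2) B'(1) by (simp add: pos_less_divide_eq mult.commute)
    finally have "U ** U0 \<in> T q"
      using U U0 by (intro d G_mult)
    moreover have "U0 \<in> T q"
      using d U0 by simp
    ultimately have "near_one L (\<eta> / 2 + \<eta> / 2) ((U ** U0 ** matrix_inv q) ** matrix_inv (U0 ** matrix_inv q))"
      by (intro near_one_mult near_one_inverse T_near)
    moreover have "U0 ** matrix_inv q \<in> G"
      using U0 q D(2) by (intro G_mult inv_in_G) auto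
    then have "(U ** U0 ** matrix_inv q) ** matrix_inv (U0 ** matrix_inv q) = U"
      by (metis matrix_mul_assoc matrix_mul_rid matrix_inv_right invertible_G)
    ultimately show ?thesis
      by simp
  qed
  then show ?thesis
    using d B' by (intro exI[of _ "d / B'"]) auto
qed

end

section \<open>The semigroup of a family of generators\<close>

inductive_set semigroup_of :: "(complex^'n^'n) set \<Rightarrow> (complex^'n^'n) set" for C where
  one: "mat 1 \<in> semigroup_of C"
| mult: "0 \<le> t \<Longrightarrow> A \<in> C \<Longrightarrow> U \<in> semigroup_of C \<Longrightarrow> matrix_exp (t *\<^sub>R A) ** U \<in> semigroup_of C"

lemma semigroup_of_mult: "U \<in> semigroup_of C \<Longrightarrow> V \<in> semigroup_of C \<Longrightarrow> U ** V \<in> semigroup_of C"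
  by (induction rule: semigroup_of.induct) (auto intro: semigroup_of.mult simp flip: matrix_mul_assoc)

lemma semigroup_of_exp: "0 \<le> t \<Longrightarrow> A \<in> C \<Longrightarrow> matrix_exp (t *\<^sub>R A) \<in> semigroup_of C"
  using semigroup_of.mult[OF _ _ semigroup_of.one, of t A C] by simp

text \<open>Both sides are the derivative of \<open>matrix_exp (t *\<^sub>R A)\<close> at
  \<open>t = 1\<close>.\<close>

lemma matrix_exp_commute: "matrix_exp A ** A = A ** matrix_exp A"
  using vector_derivative_unique_at[OF matrix_exp_has_vector_derivative_right
      matrix_exp_has_vector_derivative, of 1 A] by simp

lemma matrix_exp_Ad_self: "matrix_exp (- A) ** A ** matrix_exp A = A"
proof -
  have "matrix_exp (- A) ** A ** matrix_exp A = (matrix_exp (- A) ** matrix_exp A) ** A"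
    by (simp only: matrix_mul_assoc[symmetric] matrix_exp_commute)
  then show ?thesis
    by simp
qed

text \<open>Only \<open>t \<ge> 0\<close> is at hand when the curve comes from a semigroup; the
  right difference quotients lie in the closed set \<open>W\<close> and already determine the
  derivative.\<close>

lemma closed_subspace_vector_derivative:
  fixes \<phi> :: "real \<Rightarrow> 'a::euclidean_space"
  assumes W: "subspace W" and \<phi>: "\<And>t. 0 \<le> t \<Longrightarrow> \<phi> t \<in> W" and D: "(\<phi> has_vector_derivative D) (at 0)"
  shows "D \<in> W"
proof -
  have "((\<lambda>h. (\<phi> h - \<phi> 0) /\<^sub>R h) \<longlongrightarrow> D) (at 0)"
  proof (rule LIM_zero_cancel, rule tendsto_norm_zero_cancel)
    have "((\<lambda>h. norm (\<phi> h - \<phi> 0 - h *\<^sub>R D) / norm h) \<longlongrightarrow> 0) (at 0)"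
      using D by (simp add: has_vector_derivative_def has_derivative_at)
    moreover have "norm ((\<phi> h - \<phi> 0) /\<^sub>R h - D) = norm (\<phi> h - \<phi> 0 - h *\<^sub>R D) / norm h" if "h \<noteq> 0" for h
    proof -
      have "(\<phi> h - \<phi> 0) /\<^sub>R h - D = (\<phi> h - \<phi> 0 - h *\<^sub>R D) /\<^sub>R h"
        using that by (simp add: scaleR_diff_right)
      then show ?thesis
        by (simp add: divide_inverse mult.commute)
    qed
    ultimately show "((\<lambda>h. norm ((\<phi> h - \<phi> 0) /\<^sub>R h - D)) \<longlongrightarrow> 0) (at 0)"
      by (auto simp: eventually_at_filter elim!: Lim_transform_eventually)
  qed
  then have "((\<lambda>h. (\<phi> h - \<phi> 0) /\<^sub>R h) \<longlongrightarrow> D) (at_right 0)"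
    by (rule filterlim_mono) (auto simp: at_within_le_at)
  moreover have "eventually (\<lambda>h. (\<phi> h - \<phi> 0) /\<^sub>R h \<in> W) (at_right 0)"
    unfolding eventually_at_right_field
    by (intro exI[of _ 1]) (auto intro!: subspace_scale[OF W] subspace_diff[OF W] \<phi>)
  ultimately show ?thesis
    using closed_subspace[OF W] by (intro Lim_in_closed_set[of W]) auto
qed

context matrix_lie_algebra
begin

lemma semigroup_of_subset_G: "C \<subseteq> L \<Longrightarrow> semigroup_of C \<subseteq> G"
proof
  fix U assume "C \<subseteq> L" "U \<in> semigroup_of C"
  from this(2,1) show "U \<in> G"
    by (induction rule: semigroup_of.induct) (auto intro!: lie_group_of.intros subspace_scale[OF subspace])
qed

text \<open>
  The span \<open>W\<close> of the conjugates is invariant under the semigroup, hence under brackets with \<open>C\<close>;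
  therefore it is an ideal of \<open>L\<close> containing the generators.
\<close>

lemma span_conjugates:
  assumes L: "L = lie_subalgebra hull C"
  shows "L \<subseteq> span {matrix_inv s ** A ** s | s A. s \<in> semigroup_of C \<and> A \<in> C}"
proof -
  let ?gens = "{matrix_inv s ** A ** s | s A. s \<in> semigroup_of C \<and> A \<in> C}"
  define W where "W = span ?gens"
  have CL: "C \<subseteq> L"
    unfolding L by (rule hull_subset)
  note SG = semigroup_of_subset_G[OF CL]
  have W: "subspace W"
    unfolding W_def by (rule subspace_span)
  have "?gens \<subseteq> L"
  proof clarify
    fix s A assume "s \<in> semigroup_of C" "A \<in> C"
    moreover from this have "s \<in> G"
      using SG by blast
    moreover from this have "matrix_inv (matrix_inv s) = s"
      by (intro inverse_unique_mat) simp_all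
    ultimately show "matrix_inv s ** A ** s \<in> L"
      using Ad_in_L[of "matrix_inv s" A] CL by auto
  qed
  then have WL: "W \<subseteq> L"
    unfolding W_def by (rule span_minimal) (rule subspace)
  \<comment> \<open>Conjugation sends the generator of \<open>W\<close> belonging to
    \<open>s\<close> to the one belonging to \<open>s ** matrix_exp (t *\<^sub>R A)\<close>, which
    is again in the semigroup because \<open>0 \<le> t\<close>.\<close>
  have Ad: "matrix_exp (- (t *\<^sub>R A)) ** w ** matrix_exp (t *\<^sub>R A) \<in> W" if "0 \<le> t" "A \<in> C" "w \<in> W" for t A w
  proof -
    let ?f = "\<lambda>w. matrix_exp (- (t *\<^sub>R A)) ** w ** matrix_exp (t *\<^sub>R A)"
    have lin: "linear ?f"
      by (rule linearI) (simp_all add: mm.add_left mm.add_right mm.scaleR_left mm.scaleR_right)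
    have "?f x \<in> ?gens" if gen: "x \<in> ?gens" for x
    proof -
      obtain s B where x: "x = matrix_inv s ** B ** s" "s \<in> semigroup_of C" "B \<in> C"
        using gen by blast
      then have "invertible s"
        using SG by auto
      then have "?f x = matrix_inv (s ** matrix_exp (t *\<^sub>R A)) ** B ** (s ** matrix_exp (t *\<^sub>R A))"
        by (simp add: x matrix_inv_mult matrix_mul_assoc)
      then show ?thesis
        using x \<open>0 \<le> t\<close> \<open>A \<in> C\<close> semigroup_of_mult semigroup_of_exp by blast
    qed
    then have "?f ` W \<subseteq> W"
      unfolding W_def linear_span_image[OF lin, symmetric] by (intro span_mono image_subsetI)
    then show ?thesis
      using \<open>w \<in> W\<close> by blast
  qed
  \<comment> \<open>The matrices whose brackets preserve \<open>W\<close>. By the Jacobi identity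
    they form a Lie subalgebra, which contains \<open>L\<close> as soon as it contains
    \<open>C\<close>; the latter follows by differentiating \<open>Ad\<close> at time zero.\<close>
  define N where "N = {X. \<forall>w\<in>W. X ** w - w ** X \<in> W}"
  have "lie_subalgebra N"
    unfolding lie_subalgebra_def
  proof (intro conjI ballI)
    show "subspace N"
    proof (intro subspaceI)
      show "x + y \<in> N" if "x \<in> N" "y \<in> N" for x y
        unfolding N_def
      proof (intro CollectI ballI)
        fix w assume "w \<in> W"
        then have "(x ** w - w ** x) + (y ** w - w ** y) \<in> W"
          using that by (auto simp: N_def intro: subspace_add[OF W])
        then show "(x + y) ** w - w ** (x + y) \<in> W"
          by (simp add: mm.add_left mm.add_right algebra_simps)
      qed
      show "c *\<^sub>R x \<in> N" if "x \<in> N" for c x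
        using that by (auto simp: N_def mm.scaleR_left mm.scaleR_right scaleR_diff_right[symmetric]
            intro: subspace_scale[OF W])
    qed (simp add: N_def subspace_0[OF W])
    show "x ** y - y ** x \<in> N" if "x \<in> N" "y \<in> N" for x y
      unfolding N_def
    proof (intro CollectI ballI)
      fix w assume w: "w \<in> W"
      have "x ** (y ** w - w ** y) - (y ** w - w ** y) ** x \<in> W"
        "y ** (x ** w - w ** x) - (x ** w - w ** x) ** y \<in> W"
        using that w by (auto simp: N_def)
      then have "(x ** (y ** w - w ** y) - (y ** w - w ** y) ** x)
          - (y ** (x ** w - w ** x) - (x ** w - w ** x) ** y) \<in> W"
        by (rule subspace_diff[OF W])
      then show "(x ** y - y ** x) ** w - w ** (x ** y - y ** x) \<in> W"
        by (simp add: mm.diff_left mm.diff_right matrix_mul_assoc algebra_simps)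
    qed
  qed
  moreover have "C \<subseteq> N"
    unfolding N_def
  proof clarify
    fix A w assume A: "A \<in> C" and w: "w \<in> W"
    have deriv: "((\<lambda>t. matrix_exp (t *\<^sub>R (- A)) ** w ** matrix_exp (t *\<^sub>R A)) has_vector_derivative
       (matrix_exp (0 *\<^sub>R (- A)) ** w) ** (A ** matrix_exp (0 *\<^sub>R A)) +
       (matrix_exp (0 *\<^sub>R (- A)) ** 0 + (- A ** matrix_exp (0 *\<^sub>R (- A))) ** w) ** matrix_exp (0 *\<^sub>R A)) (at 0)"
      by (rule mm.has_vector_derivative[OF mm.has_vector_derivative[OF
            matrix_exp_has_vector_derivative has_vector_derivative_const] matrix_exp_has_vector_derivative])
    have "(matrix_exp (0 *\<^sub>R (- A)) ** w) ** (A ** matrix_exp (0 *\<^sub>R A)) +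
       (matrix_exp (0 *\<^sub>R (- A)) ** 0 + (- A ** matrix_exp (0 *\<^sub>R (- A))) ** w) ** matrix_exp (0 *\<^sub>R A) \<in> W"
      by (rule closed_subspace_vector_derivative[OF W _ deriv]) (simp add: Ad[OF _ A w])
    then have "w ** A - A ** w \<in> W"
      by (simp add: mm.minus_left mm.zero_right)
    then have "- (w ** A - A ** w) \<in> W"
      by (rule subspace_neg[OF W])
    then show "A ** w - w ** A \<in> W"
      by simp
  qed
  ultimately have LN: "L \<subseteq> N"
    unfolding L by (intro hull_minimal)
  have "lie_subalgebra W"
    using W WL LN by (auto simp: lie_subalgebra_def N_def)
  moreover have "C \<subseteq> W"
  proof
    fix A assume "A \<in> C"
    then have "A \<in> ?gens"
      using semigroup_of.one[of C] by (intro CollectI exI[of _ "mat 1"] exI[of _ A]) simp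
    then show "A \<in> W"
      unfolding W_def by (rule span_base)
  qed
  ultimately have "L \<subseteq> W"
    unfolding L by (intro hull_minimal)
  then show ?thesis
    unfolding W_def .
qed

text \<open>A longest list with independent frame vectors spans. Otherwise some
  \<open>matrix_inv s ** A ** s\<close> lies outside the span, and \<open>(A, g)\<close> with
  \<open>g = matrix_exp A ** s\<close> can be prepended: the old vectors get conjugated by
  \<open>g\<close>, and pulling \<open>A\<close> back through \<open>g\<close> gives exactly the
  outside vector.\<close>

lemma exists_full_frame:
  assumes L: "L = lie_subalgebra hull C"
  shows "\<exists>l. (\<forall>(A, g)\<in>set l. A \<in> C \<and> (\<exists>s\<in>semigroup_of C. g = matrix_exp A ** s)) \<and>
    distinct (frame_vectors l) \<and> independent (set (frame_vectors l)) \<and> L \<subseteq> span (set (frame_vectors l))"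
proof -
  have CL: "C \<subseteq> L"
    unfolding L by (rule hull_subset)
  note SG = semigroup_of_subset_G[OF CL]
  define P where "P l \<longleftrightarrow> (\<forall>(A, g)\<in>set l. A \<in> C \<and> (\<exists>s\<in>semigroup_of C. g = matrix_exp A ** s)) \<and>
    distinct (frame_vectors l) \<and> independent (set (frame_vectors l))" for l
  have "P []"
    by (simp add: P_def independent_empty)
  moreover have "\<forall>l. P l \<longrightarrow> length l < Suc (DIM(complex^'n^'n))"
  proof (intro allI impI)
    fix l assume "P l"
    then have "card (set (frame_vectors l)) = length l" "card (set (frame_vectors l)) \<le> DIM(complex^'n^'n)"
      using independent_bound[of "set (frame_vectors l)"] by (auto simp: P_def distinct_card)
    then show "length l < Suc (DIM(complex^'n^'n))"
      by simp
  qed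
  ultimately have "\<exists>l. P l \<and> (\<forall>l'. P l' \<longrightarrow> length l' \<le> length l)"
    by (rule ex_has_greatest_nat)
  then obtain l where l: "P l" and max: "\<And>l'. P l' \<Longrightarrow> length l' \<le> length l"
    by auto
  let ?B = "set (frame_vectors l)"
  have "L \<subseteq> span ?B"
  proof (rule ccontr)
    assume "\<not> L \<subseteq> span ?B"
    have "\<not> {matrix_inv s ** A ** s | s A. s \<in> semigroup_of C \<and> A \<in> C} \<subseteq> span ?B"
    proof
      assume "{matrix_inv s ** A ** s | s A. s \<in> semigroup_of C \<and> A \<in> C} \<subseteq> span ?B"
      from order_trans[OF span_conjugates[OF L] span_minimal[OF this subspace_span]] \<open>\<not> L \<subseteq> span ?B\<close>
      show False
        by contradiction
    qed
    then obtain s A where s: "s \<in> semigroup_of C" "A \<in> C" "matrix_inv s ** A ** s \<notin> span ?B"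
      by auto
    \<comment> \<open>The extra factor \<open>matrix_exp A\<close> commutes with \<open>A\<close>
      and so leaves the pulled back vector unchanged; its purpose is to make room for negative
      times.\<close>
    define g where "g = matrix_exp A ** s"
    have s_inv: "invertible s"
      using s SG by auto
    then have g_inv: "invertible g" "matrix_inv g = matrix_inv s ** matrix_exp (- A)"
      by (simp_all add: g_def invertible_mult matrix_inv_mult)
    let ?f = "\<lambda>X. g ** X ** matrix_inv g"
    have lin: "linear ?f"
      by (rule linearI) (simp_all add: mm.add_left mm.add_right mm.scaleR_left mm.scaleR_right)
    have left_inv: "matrix_inv g ** ?f X ** g = X" for X
    proof -
      have "matrix_inv g ** ?f X ** g = (matrix_inv g ** g) ** X ** (matrix_inv g ** g)"
        by (simp only: matrix_mul_assoc)
      then show ?thesis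
        using g_inv(1) by simp
    qed
    have inj: "inj ?f"
      by (rule inj_on_inverseI[of _ "\<lambda>X. matrix_inv g ** X ** g"]) (rule left_inv)
    have A_notin: "A \<notin> span (?f ` ?B)"
    proof
      assume "A \<in> span (?f ` ?B)"
      then obtain X where X: "X \<in> span ?B" "A = ?f X"
        by (auto simp: linear_span_image[OF lin])
      have "X = matrix_inv g ** A ** g"
        by (subst X(2)) (rule left_inv[symmetric])
      also have "\<dots> = matrix_inv s ** (matrix_exp (- A) ** A ** matrix_exp A) ** s"
        unfolding g_inv(2) by (simp only: g_def matrix_mul_assoc)
      finally have "X = matrix_inv s ** A ** s"
        by (simp only: matrix_exp_Ad_self)
      then show False
        using X(1) s(3) by simp
    qed
    have "P ((A, g) # l)"
      unfolding P_def
    proof (intro conjI)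
      have "A \<notin> ?f ` ?B"
        by (rule contrapos_nn[OF A_notin span_base])
      moreover have "distinct (map ?f (frame_vectors l))"
        using l inj_on_subset[OF inj subset_UNIV] by (simp add: P_def distinct_map)
      ultimately show "distinct (frame_vectors ((A, g) # l))"
        by simp
      have "independent ?B"
        using l by (simp add: P_def)
      then have "independent (?f ` ?B)"
        using inj_on_subset[OF inj subset_UNIV] by (rule linear_independent_injective_image[OF lin])
      then have "independent (insert A (?f ` ?B))"
        using A_notin by (rule independent_insertI[rotated])
      then show "independent (set (frame_vectors ((A, g) # l)))"
        by simp
      show "\<forall>(A, g)\<in>set ((A, g) # l). A \<in> C \<and> (\<exists>s\<in>semigroup_of C. g = matrix_exp A ** s)"
      proof -
        have "\<exists>s\<in>semigroup_of C. g = matrix_exp A ** s"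
          using s(1) g_def by (rule bexI[rotated])
        then show ?thesis
          using l s(2) by (simp add: P_def)
      qed
    qed
    then show False
      using max[of "(A, g) # l"] by simp
  qed
  then show ?thesis
    using l unfolding P_def by blast
qed

text \<open>Each \<open>g\<close> starts with \<open>matrix_exp A\<close>, which merges with
  \<open>matrix_exp (t *\<^sub>R A)\<close> into a run of duration \<open>t + 1 \<ge> 0\<close>.
  Hence times on both sides of zero, as a chart needs them, stay in the semigroup.\<close>

lemma word_in_semigroup:
  assumes "\<forall>(A, g)\<in>set l. A \<in> C \<and> (\<exists>s\<in>semigroup_of C. g = matrix_exp A ** s)" "\<forall>t\<in>set ts. - 1 \<le> t"
  shows "word l ts \<in> semigroup_of C"
  using assms
proof (induction l ts rule: word.induct)
  case (1 A g l t ts)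
  then obtain s where s: "A \<in> C" "s \<in> semigroup_of C" "g = matrix_exp A ** s"
    by auto
  have "matrix_exp ((t + 1) *\<^sub>R A) ** s \<in> semigroup_of C"
    using 1 s by (intro semigroup_of.mult) auto
  moreover have "matrix_exp ((t + 1) *\<^sub>R A) ** s = matrix_exp (t *\<^sub>R A) ** g"
    unfolding s(3) using matrix_exp_add_scaleR[of t 1 A] by (simp add: matrix_mul_assoc)
  ultimately show ?case
    using 1 by (auto intro: semigroup_of_mult)
qed (auto intro: semigroup_of.one)

lemma semigroup_intrinsic_interior:
  assumes L: "L = lie_subalgebra hull C"
  shows "\<exists>s\<in>semigroup_of C. \<exists>\<rho>>0. \<forall>U. near_one L \<rho> U \<longrightarrow> U ** s \<in> semigroup_of C"
proof -
  have CL: "C \<subseteq> L"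
    unfolding L by (rule hull_subset)
  obtain l where l: "\<forall>(A, g)\<in>set l. A \<in> C \<and> (\<exists>s\<in>semigroup_of C. g = matrix_exp A ** s)"
    and basis: "distinct (frame_vectors l)" "independent (set (frame_vectors l))" "L \<subseteq> span (set (frame_vectors l))"
    using exists_full_frame[OF L] by blast
  have "\<forall>(A, g)\<in>set l. A \<in> L \<and> g \<in> G"
    using l CL semigroup_of_subset_G[OF CL] by (fastforce intro: G_mult G_exp)
  then obtain cs where cs: "\<forall>c\<in>set cs. linear (c :: complex^'n^'n \<Rightarrow> real)"
    and covers: "\<And>\<epsilon>. \<epsilon> > 0 \<Longrightarrow> \<exists>\<rho>>0. \<forall>U. near_one L \<rho> U \<longrightarrow>
      (\<exists>Y. norm Y \<le> \<epsilon> \<and> word l (map (\<lambda>c. c Y) cs) = U ** word l (map (\<lambda>_. 0) l))"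
    using word_covers_near_one[OF _ basis] by metis
  obtain K where K: "K > 0" "\<forall>c\<in>set cs. \<forall>Y. \<bar>c Y\<bar> \<le> K * norm Y"
    using linear_list_bound[OF cs] by blast
  \<comment> \<open>The radius \<open>1 / K\<close> keeps every time \<open>c Y\<close> between -1
    and 1.\<close>
  obtain \<rho> where \<rho>: "\<rho> > 0" "\<And>U. near_one L \<rho> U \<Longrightarrow>
      \<exists>Y. norm Y \<le> 1 / K \<and> word l (map (\<lambda>c. c Y) cs) = U ** word l (map (\<lambda>_. 0) l)"
    using covers[of "1 / K"] K(1) by auto
  have "U ** word l (map (\<lambda>_. 0) l) \<in> semigroup_of C" if U: "near_one L \<rho> U" for U
  proof -
    obtain Y where Y: "norm Y \<le> 1 / K" "word l (map (\<lambda>c. c Y) cs) = U ** word l (map (\<lambda>_. 0) l)"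
      using \<rho>(2)[OF U] by blast
    have "- 1 \<le> c Y" if "c \<in> set cs" for c
    proof -
      have "\<bar>c Y\<bar> \<le> K * norm Y"
        using K that by blast
      also have "\<dots> \<le> 1"
        using Y(1) K(1) by (simp add: pos_le_divide_eq mult.commute)
      finally show ?thesis
        by simp
    qed
    then show ?thesis
      unfolding Y(2)[symmetric] using l by (intro word_in_semigroup) auto
  qed
  moreover have "word l (map (\<lambda>_. 0) l) \<in> semigroup_of C"
    using l by (intro word_in_semigroup) auto
  ultimately show ?thesis
    using \<rho>(1) by blast
qed

end

section \<open>Recurrence, and equality of semigroup and group\<close>

text \<open>Powers of \<open>U\<close> accumulate in the compact \<open>G\<close>, and the quotient
  of two close powers is a power near the identity. The exponent is \<open>Suc k\<close> because the
  zeroth power would carry no information.\<close>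

lemma (in compact_matrix_lie_group) recurrence:
  assumes U: "U \<in> G" and "\<delta> > 0"
  shows "\<exists>k. norm (((**) U ^^ Suc k) (mat 1) - mat 1) < \<delta>"
proof -
  define pw where "pw k = ((**) U ^^ k) (mat 1)" for k
  have pw_G: "pw k \<in> G" for k
    unfolding pw_def by (induction k) (auto intro: lie_group_of.one G_mult U)
  have pw_add: "pw (i + k) = pw i ** pw k" for i k
    unfolding pw_def by (induction i) (auto simp: matrix_mul_assoc)
  obtain K where K: "K > 0" "\<forall>U\<in>G. \<forall>X :: complex^'n^'n. norm (U ** X) \<le> K * norm X \<and> norm (X ** U) \<le> K * norm X"
    using mult_bound by blast
  obtain l r where "strict_mono r" "(pw \<circ> r) \<longlonglongrightarrow> l"
    using compact_G pw_G unfolding compact_def by metis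
  then have "Cauchy (pw \<circ> r)"
    by (simp add: LIMSEQ_imp_Cauchy)
  then obtain M where M: "\<And>m n. m \<ge> M \<Longrightarrow> n \<ge> M \<Longrightarrow> dist (pw (r m)) (pw (r n)) < \<delta> / K"
    using \<open>\<delta> > 0\<close> K(1) unfolding Cauchy_def o_def by (meson divide_pos_pos)
  have "r M < r (Suc M)"
    using \<open>strict_mono r\<close> by (simp add: strict_mono_def)
  then obtain k where k: "r (Suc M) = r M + Suc k"
    using less_imp_Suc_add by fastforce
  have "pw (Suc k) - mat 1 = matrix_inv (pw (r M)) ** (pw (r (Suc M)) - pw (r M))"
    using pw_G by (simp add: k pw_add mm.diff_right matrix_mul_assoc del: add_Suc_right)
  then have "norm (pw (Suc k) - mat 1) \<le> K * norm (pw (r (Suc M)) - pw (r M))"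
    using K(2) pw_G by simp
  also have "\<dots> < \<delta>"
    using M[of "Suc M" M] K(1) by (simp add: dist_norm pos_less_divide_eq mult.commute)
  finally show ?thesis
    unfolding pw_def by blast
qed

theorem (in compact_matrix_lie_group) G_subset_semigroup_of:
  assumes L: "L = lie_subalgebra hull C"
  shows "G \<subseteq> semigroup_of C"
proof -
  have CL: "C \<subseteq> L"
    unfolding L by (rule hull_subset)
  obtain s \<rho> where s: "s \<in> semigroup_of C" and "\<rho> > 0"
    and \<rho>: "\<And>U. near_one L \<rho> U \<Longrightarrow> U ** s \<in> semigroup_of C"
    using semigroup_intrinsic_interior[OF L] by blast
  have sG: "s \<in> G"
    using s semigroup_of_subset_G[OF CL] by blast
  obtain \<delta> where "\<delta> > 0" and \<delta>: "\<And>U. U \<in> G \<Longrightarrow> norm (U - mat 1) < \<delta> \<Longrightarrow> near_one L (\<rho> / 2) U"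
    using near_one_of_norm[of "\<rho> / 2"] \<open>\<rho> > 0\<close> by auto
  obtain k where k: "norm (((**) s ^^ Suc k) (mat 1) - mat 1) < \<delta>"
    using recurrence[OF sG \<open>\<delta> > 0\<close>] by blast
  define p where "p = ((**) s ^^ k) (mat 1)"
  have p: "p \<in> semigroup_of C"
    unfolding p_def by (induction k) (auto intro: semigroup_of.one semigroup_of_mult s)
  have spG: "s ** p \<in> G"
    using s p semigroup_of_mult semigroup_of_subset_G[OF CL] by blast
  have near: "near_one L (\<rho> / 2) (s ** p)"
    using k by (intro \<delta> spG) (simp add: p_def)
  show ?thesis
  proof (rule G_generated_by_near_one)
    fix U V assume U: "near_one L (\<rho> / 2) U" and V: "V \<in> semigroup_of C"
    \<comment> \<open>\<open>U\<close> is written as \<open>U ** matrix_inv (s ** p)\<close> times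
      \<open>s\<close> times \<open>p\<close>. The first factor has length at most
      \<open>\<rho>\<close>, so together with \<open>s\<close> it is in the semigroup, and so is
      \<open>p\<close>; the inverse never has to be reached itself.\<close>
    have "near_one L (\<rho> / 2 + \<rho> / 2) (U ** matrix_inv (s ** p))"
      by (intro near_one_mult near_one_inverse U near)
    then have "U ** matrix_inv (s ** p) ** s \<in> semigroup_of C"
      by (intro \<rho>) simp
    then have "U ** matrix_inv (s ** p) ** s ** p \<in> semigroup_of C"
      using p by (rule semigroup_of_mult)
    moreover have "U ** matrix_inv (s ** p) ** s ** p = U ** (matrix_inv (s ** p) ** (s ** p))"
      by (simp only: matrix_mul_assoc)
    ultimately show "U ** V \<in> semigroup_of C"
      using spG V by (simp add: semigroup_of_mult)
  qed (use \<open>\<rho> > 0\<close> semigroup_of.one in auto)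
qed

section \<open>The controlled equation\<close>

lemma bounded_bilinear_matrix_vector_mult:
  "bounded_bilinear ((*v) :: complex^'n^'m \<Rightarrow> complex^'n \<Rightarrow> complex^'m)"
proof -
  have "bilinear ((*v) :: complex^'n^'m \<Rightarrow> complex^'n \<Rightarrow> complex^'m)"
    unfolding bilinear_def matrix_vector_mult_def
    by (intro conjI allI linearI; simp only: vec_eq_iff)
       (simp_all only: distrib_left distrib_right sum.distrib scaleR_sum_right mult_scaleR_left
         mult_scaleR_right vector_add_component vector_scaleR_component vec_lambda_beta simp_thms)
  then show ?thesis
    by (simp add: bilinear_conv_bounded_bilinear)
qed

interpretation mv: bounded_bilinear "(*v) :: complex^'n^'m \<Rightarrow> complex^'n \<Rightarrow> complex^'m"
  by (rule bounded_bilinear_matrix_vector_mult)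

text \<open>The factor \<open>- \<i> * J\<close> of the Schroedinger equation is absorbed into
  \<open>A\<close> and \<open>B\<close>, which then belong to the real Lie algebra itself.\<close>

definition bilinear_solution ::
  "complex^'n^'n \<Rightarrow> complex^'n^'n \<Rightarrow> (real \<Rightarrow> real) \<Rightarrow> (real \<Rightarrow> complex^'n) \<Rightarrow> bool" where
  "bilinear_solution A B f \<psi> \<longleftrightarrow> continuous_on {0..} \<psi> \<and>
     (\<forall>t\<ge>0. ((\<lambda>s. (A + f s *\<^sub>R B) *v \<psi> s) has_integral (\<psi> t - \<psi> 0)) {0..t})"

lemma bilinear_solution_increment:
  assumes sol: "bilinear_solution A B f \<psi>" and "0 \<le> s" "s \<le> t"
  shows "((\<lambda>u. (A + f u *\<^sub>R B) *v \<psi> u) has_integral (\<psi> t - \<psi> s)) {s..t}"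
proof -
  let ?g = "\<lambda>u. (A + f u *\<^sub>R B) *v \<psi> u"
  have I: "(?g has_integral (\<psi> t - \<psi> 0)) {0..t}" "(?g has_integral (\<psi> s - \<psi> 0)) {0..s}"
    using assms by (auto simp: bilinear_solution_def)
  have "?g integrable_on {s..t}"
    using integrable_subinterval_real[OF has_integral_integrable[OF I(1)], of s t] assms by auto
  moreover have "integral {0..s} ?g + integral {s..t} ?g = integral {0..t} ?g"
    using assms I by (intro Henstock_Kurzweil_Integration.integral_combine) auto
  then have "integral {s..t} ?g = \<psi> t - \<psi> s"
    unfolding integral_unique[OF I(1)] integral_unique[OF I(2)] by (simp add: eq_diff_eq add.commute)
  ultimately show ?thesis
    by (simp add: has_integral_iff)
qed

text \<open>Both \<open>\<psi> t\<close> and \<open>matrix_exp D *v \<psi> s\<close>, with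
  \<open>D\<close> the integrated generator, equal \<open>\<psi> s + D *v \<psi> s\<close> up to
  second order. Since \<open>f\<close> may be unbounded, smallness is measured by the integral of
  \<open>1 + \<bar>f\<bar>\<close> and not by \<open>t - s\<close>.\<close>

lemma bilinear_solution_near_exp:
  fixes A B :: "complex^'n^'n"
  assumes sol: "bilinear_solution A B f \<psi>" and adm: "admissible_control f" and "0 \<le> T"
  shows "\<exists>C\<ge>0. \<exists>\<delta>>0. \<forall>s t. 0 \<le> s \<longrightarrow> s \<le> t \<longrightarrow> t \<le> T \<longrightarrow> integral {s..t} (\<lambda>u. 1 + \<bar>f u\<bar>) \<le> \<delta> \<longrightarrow>
    norm (\<psi> t - matrix_exp ((t - s) *\<^sub>R A + integral {s..t} f *\<^sub>R B) *v \<psi> s)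
      \<le> C * (integral {s..t} (\<lambda>u. 1 + \<bar>f u\<bar>))\<^sup>2"
proof -
  have "continuous_on {0..T} \<psi>"
    using sol unfolding bilinear_solution_def by (auto intro: continuous_on_subset)
  then have "bounded (\<psi> ` {0..T})"
    by (intro compact_imp_bounded compact_continuous_image) auto
  then obtain R where R: "R > 0" "\<And>u. 0 \<le> u \<Longrightarrow> u \<le> T \<Longrightarrow> norm (\<psi> u) \<le> R"
    unfolding bounded_pos by auto
  have "\<exists>K>0. \<forall>(X :: complex^'n^'n) (x :: complex^'n). norm (X *v x) \<le> norm X * norm x * K"
    by (rule mv.pos_bounded)
  then obtain K where K: "K > 0" "\<And>(X :: complex^'n^'n) (x :: complex^'n). norm (X *v x) \<le> norm X * norm x * K"
    by auto
  obtain C1 \<delta>1 where C1: "C1 > 0" "\<delta>1 > 0"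
      "\<And>X :: complex^'n^'n. norm X \<le> \<delta>1 \<Longrightarrow> norm (matrix_exp X - mat 1 - X) \<le> C1 * (norm X)\<^sup>2"
    using norm_matrix_exp_minus_one_minus by blast
  define m where "m = norm A + norm B + 1"
  have m: "m > 0"
    by (simp add: m_def add_nonneg_pos)
  define g where "g u = A + f u *\<^sub>R B" for u
  have g: "norm (g u) \<le> m * (1 + \<bar>f u\<bar>)" for u
  proof -
    have "norm (g u) \<le> norm A + \<bar>f u\<bar> * norm B"
      unfolding g_def by (metis norm_triangle_ineq norm_scaleR real_norm_def)
    also have "\<dots> \<le> m * 1 + m * \<bar>f u\<bar>"
      unfolding m_def mult.commute[of "\<bar>f u\<bar>"] by (intro add_mono mult_right_mono) auto
    finally show ?thesis
      by (simp add: distrib_left)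
  qed
  have main: "norm (\<psi> t - matrix_exp ((t - s) *\<^sub>R A + integral {s..t} f *\<^sub>R B) *v \<psi> s)
      \<le> (K * m * (K * m * R) + C1 * m\<^sup>2 * R * K) * (integral {s..t} (\<lambda>u. 1 + \<bar>f u\<bar>))\<^sup>2"
    if st: "0 \<le> s" "s \<le> t" "t \<le> T" and small: "integral {s..t} (\<lambda>u. 1 + \<bar>f u\<bar>) \<le> \<delta>1 / m" for s t
  proof -
    have f_abs: "f absolutely_integrable_on {s..t}"
    proof (rule absolutely_integrable_on_subinterval)
      show "f absolutely_integrable_on {0..t}"
        using adm st by (simp add: admissible_control_def)
    qed (use st in simp)
    have f_int: "f integrable_on {s..t}"
      using f_abs by (rule set_lebesgue_integral_eq_integral(1))
    have "(\<lambda>u. \<bar>f u\<bar>) integrable_on {s..t}"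
      using f_abs unfolding absolutely_integrable_on_def real_norm_def by (rule conjunct2)
    then have h_int: "(\<lambda>u. 1 + \<bar>f u\<bar>) integrable_on {s..t}"
      by (intro integrable_add integrable_const_ivl)
    define \<Lambda> where "\<Lambda> = integral {s..t} (\<lambda>u. 1 + \<bar>f u\<bar>)"
    have \<Lambda>0: "\<Lambda> \<ge> 0"
      unfolding \<Lambda>_def by (intro integral_nonneg h_int) auto
    \<comment> \<open>A first-order bound on the change of \<open>\<psi>\<close>; fed back into the
      integral equation it yields the second-order bound \<open>part1\<close>.\<close>
    have incr: "norm (\<psi> u - \<psi> s) \<le> K * m * R * \<Lambda>" if u: "s \<le> u" "u \<le> t" for u
    proof -
      have I: "((\<lambda>v. g v *v \<psi> v) has_integral (\<psi> u - \<psi> s)) {s..u}"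
        unfolding g_def using sol st u by (intro bilinear_solution_increment) auto
      have h_int_u: "(\<lambda>u. 1 + \<bar>f u\<bar>) integrable_on {s..u}"
        using integrable_subinterval_real[OF h_int, of s u] u by auto
      have "norm (integral {s..u} (\<lambda>v. g v *v \<psi> v)) \<le> integral {s..u} (\<lambda>v. K * m * R * (1 + \<bar>f v\<bar>))"
      proof (rule Henstock_Kurzweil_Integration.integral_norm_bound_integral)
        show "norm (g v *v \<psi> v) \<le> K * m * R * (1 + \<bar>f v\<bar>)" if "v \<in> {s..u}" for v
        proof -
          have "norm (g v *v \<psi> v) \<le> (m * (1 + \<bar>f v\<bar>)) * R * K"
            using that st u R K(1) g[of v] m
            by (intro order_trans[OF K(2)] mult_right_mono mult_mono) auto
          then show ?thesis
            by (simp add: mult_ac)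
        qed
      qed (use I h_int_u in \<open>auto intro!: integrable_on_mult_right\<close>)
      also have "\<dots> = K * m * R * integral {s..u} (\<lambda>v. 1 + \<bar>f v\<bar>)"
        by simp
      also have "\<dots> \<le> K * m * R * \<Lambda>"
        unfolding \<Lambda>_def using K m R u h_int h_int_u
        by (intro mult_left_mono integral_subset_le) auto
      finally show ?thesis
        using I by (simp add: integral_unique)
    qed
    define D where "D = (t - s) *\<^sub>R A + integral {s..t} f *\<^sub>R B"
    have D_int: "(g has_integral D) {s..t}"
      unfolding g_def D_def using st f_int
      by (intro has_integral_add has_integral_scaleR_left integrable_integral)
         (use has_integral_const_real[of A s t] in auto)
    have "norm (integral {s..t} g) \<le> integral {s..t} (\<lambda>u. m * (1 + \<bar>f u\<bar>))"
      using D_int h_int g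
      by (intro Henstock_Kurzweil_Integration.integral_norm_bound_integral) (auto intro!: integrable_on_mult_right)
    then have D: "norm D \<le> m * \<Lambda>"
      using D_int by (simp add: integral_unique \<Lambda>_def)
    have "((\<lambda>u. g u *v \<psi> s) has_integral (D *v \<psi> s)) {s..t}"
      using has_integral_linear[OF D_int mv.bounded_linear_left] by (simp add: o_def)
    moreover have "((\<lambda>v. g v *v \<psi> v) has_integral (\<psi> t - \<psi> s)) {s..t}"
      unfolding g_def using sol st by (intro bilinear_solution_increment) auto
    ultimately have "((\<lambda>v. g v *v \<psi> v - g v *v \<psi> s) has_integral (\<psi> t - \<psi> s - D *v \<psi> s)) {s..t}"
      by (intro has_integral_diff)
    then have diff: "((\<lambda>v. g v *v (\<psi> v - \<psi> s)) has_integral (\<psi> t - \<psi> s - D *v \<psi> s)) {s..t}"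
      by (simp only: mv.diff_right)
    have "norm (integral {s..t} (\<lambda>v. g v *v (\<psi> v - \<psi> s)))
        \<le> integral {s..t} (\<lambda>v. K * m * (K * m * R * \<Lambda>) * (1 + \<bar>f v\<bar>))"
    proof (rule Henstock_Kurzweil_Integration.integral_norm_bound_integral)
      show "norm (g v *v (\<psi> v - \<psi> s)) \<le> K * m * (K * m * R * \<Lambda>) * (1 + \<bar>f v\<bar>)" if "v \<in> {s..t}" for v
      proof -
        have "norm (g v *v (\<psi> v - \<psi> s)) \<le> (m * (1 + \<bar>f v\<bar>)) * (K * m * R * \<Lambda>) * K"
          using that K(1) g[of v] m incr[of v]
          by (intro order_trans[OF K(2)] mult_right_mono mult_mono) auto
        then show ?thesis
          by (simp add: mult_ac)
      qed
    qed (use diff h_int in \<open>auto intro!: integrable_on_mult_right\<close>)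
    then have part1: "norm (\<psi> t - \<psi> s - D *v \<psi> s) \<le> K * m * (K * m * R * \<Lambda>) * \<Lambda>"
      using diff by (simp add: integral_unique \<Lambda>_def)
    have "m * \<Lambda> \<le> \<delta>1"
      using small m unfolding \<Lambda>_def[symmetric] by (simp add: pos_le_divide_eq mult.commute)
    then have "norm (matrix_exp D - mat 1 - D) \<le> C1 * (norm D)\<^sup>2"
      using D by (intro C1) simp
    also have "\<dots> \<le> C1 * (m * \<Lambda>)\<^sup>2"
      using D C1(1) by (intro mult_left_mono power_mono) auto
    finally have "norm ((matrix_exp D - mat 1 - D) *v \<psi> s) \<le> C1 * (m * \<Lambda>)\<^sup>2 * R * K"
      using st R K(1) C1(1) by (intro order_trans[OF K(2)] mult_right_mono mult_mono) auto
    then have part2: "norm (matrix_exp D *v \<psi> s - \<psi> s - D *v \<psi> s) \<le> C1 * (m * \<Lambda>)\<^sup>2 * R * K"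
      by (simp add: mv.diff_left)
    have "norm (\<psi> t - matrix_exp D *v \<psi> s)
        \<le> norm (\<psi> t - \<psi> s - D *v \<psi> s) + norm (matrix_exp D *v \<psi> s - \<psi> s - D *v \<psi> s)"
      by (rule order_trans[OF _ norm_triangle_ineq4]) simp
    also have "\<dots> \<le> K * m * (K * m * R * \<Lambda>) * \<Lambda> + C1 * (m * \<Lambda>)\<^sup>2 * R * K"
      by (intro add_mono part1 part2)
    also have "\<dots> = (K * m * (K * m * R) + C1 * m\<^sup>2 * R * K) * \<Lambda>\<^sup>2"
      by (simp add: power2_eq_square algebra_simps)
    finally show ?thesis
      unfolding D_def \<Lambda>_def .
  qed
  have "0 \<le> K * m * (K * m * R) + C1 * m\<^sup>2 * R * K" "0 < \<delta>1 / m"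
    using K m R C1 by simp_all
  then show ?thesis
    using main by (intro exI[of _ "K * m * (K * m * R) + C1 * m\<^sup>2 * R * K"] exI[of _ "\<delta>1 / m"]
        conjI allI impI main)
qed

context compact_matrix_lie_group
begin

text \<open>
  Continuous induction again: \<open>W \<psi>(t)\<close> stays within \<open>\<eta> \<integral>(1 + \<bar>f\<bar>)\<close> of \<open>\<psi>(0)\<close> for some
  \<open>W \<in> G\<close>, for every \<open>\<eta> > 0\<close>, since on short intervals \<open>\<psi>\<close> is close to an exponential.
\<close>

lemma bilinear_solution_in_orbit:
  assumes AB: "A \<in> L" "B \<in> L" and sol: "bilinear_solution A B f \<psi>" and adm: "admissible_control f"
    and T: "0 \<le> T"
  shows "\<exists>U\<in>G. \<psi> T = U *v \<psi> 0"
proof -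
  define \<Lambda> where "\<Lambda> t = integral {0..t} (\<lambda>u. 1 + \<bar>f u\<bar>)" for t
  have h_int: "(\<lambda>u. 1 + \<bar>f u\<bar>) integrable_on {0..T}"
  proof -
    have "f absolutely_integrable_on {0..T}"
      using adm T by (simp add: admissible_control_def)
    then have "(\<lambda>u. \<bar>f u\<bar>) integrable_on {0..T}"
      unfolding absolutely_integrable_on_def real_norm_def by (rule conjunct2)
    then show ?thesis
      by (intro integrable_add integrable_const_ivl)
  qed
  have \<Lambda>_cont: "continuous_on {0..T} \<Lambda>"
    unfolding \<Lambda>_def by (rule indefinite_integral_continuous_1[OF h_int])
  have \<Lambda>_diff: "integral {s..t} (\<lambda>u. 1 + \<bar>f u\<bar>) = \<Lambda> t - \<Lambda> s" if "0 \<le> s" "s \<le> t" "t \<le> T" for s t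
  proof -
    have "(\<lambda>u. 1 + \<bar>f u\<bar>) integrable_on {0..t}"
      using that by (intro integrable_subinterval_real[OF h_int]) auto
    then have "integral {0..s} (\<lambda>u. 1 + \<bar>f u\<bar>) + integral {s..t} (\<lambda>u. 1 + \<bar>f u\<bar>)
        = integral {0..t} (\<lambda>u. 1 + \<bar>f u\<bar>)"
      using that by (intro Henstock_Kurzweil_Integration.integral_combine)
    then show ?thesis
      unfolding \<Lambda>_def by linarith
  qed
  have \<Lambda>_nonneg: "0 \<le> \<Lambda> t - \<Lambda> s" if "0 \<le> s" "s \<le> t" "t \<le> T" for s t
    unfolding \<Lambda>_diff[OF that, symmetric]
    using that by (intro integral_nonneg integrable_subinterval_real[OF h_int]) auto
  have \<Lambda>0: "\<Lambda> 0 = 0"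
    by (simp add: \<Lambda>_def)
  obtain C \<delta> where C: "C \<ge> 0" "\<delta> > 0"
    and exp_close: "\<And>s t. 0 \<le> s \<Longrightarrow> s \<le> t \<Longrightarrow> t \<le> T \<Longrightarrow> \<Lambda> t - \<Lambda> s \<le> \<delta> \<Longrightarrow>
      norm (\<psi> t - matrix_exp ((t - s) *\<^sub>R A + integral {s..t} f *\<^sub>R B) *v \<psi> s) \<le> C * (\<Lambda> t - \<Lambda> s)\<^sup>2"
  proof -
    obtain C \<delta> where "C \<ge> 0" "\<delta> > 0" and *: "\<forall>s t. 0 \<le> s \<longrightarrow> s \<le> t \<longrightarrow> t \<le> T \<longrightarrow>
      integral {s..t} (\<lambda>u. 1 + \<bar>f u\<bar>) \<le> \<delta> \<longrightarrow>
      norm (\<psi> t - matrix_exp ((t - s) *\<^sub>R A + integral {s..t} f *\<^sub>R B) *v \<psi> s)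
        \<le> C * (integral {s..t} (\<lambda>u. 1 + \<bar>f u\<bar>))\<^sup>2"
      using bilinear_solution_near_exp[OF sol adm T] by (elim exE conjE)
    show ?thesis
    proof (rule that[OF \<open>C \<ge> 0\<close> \<open>\<delta> > 0\<close>])
      fix s t assume st: "0 \<le> s" "s \<le> t" "t \<le> T" "\<Lambda> t - \<Lambda> s \<le> \<delta>"
      show "norm (\<psi> t - matrix_exp ((t - s) *\<^sub>R A + integral {s..t} f *\<^sub>R B) *v \<psi> s) \<le> C * (\<Lambda> t - \<Lambda> s)\<^sup>2"
        using *[rule_format, OF st(1-3)] st(4) unfolding \<Lambda>_diff[OF st(1-3)] by simp
    qed
  qed
  have "\<exists>K>0. \<forall>(X :: complex^'n^'n) (x :: complex^'n). norm (X *v x) \<le> norm X * norm x * K"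
    by (rule mv.pos_bounded)
  then obtain K where K: "K > 0" "\<And>(X :: complex^'n^'n) (x :: complex^'n). norm (X *v x) \<le> norm X * norm x * K"
    by auto
  obtain b where b: "b > 0" "\<forall>U\<in>G. norm U \<le> b"
    using compact_imp_bounded[OF compact_G] unfolding bounded_pos by auto
  have G_bound: "norm (U *v x) \<le> (b * K) * norm x" if "U \<in> G" for U x
  proof -
    have "norm (U *v x) \<le> b * norm x * K"
      using b(2) that K(1) by (intro order_trans[OF K(2)] mult_right_mono) auto
    then show ?thesis
      by (simp add: mult_ac)
  qed
  have \<psi>_cont: "continuous_on {0..T} \<psi>"
    using sol unfolding bilinear_solution_def by (auto intro: continuous_on_subset)
  have approx: "\<exists>W\<in>G. norm (W *v \<psi> T - \<psi> 0) \<le> \<eta> * \<Lambda> T" if "\<eta> > 0" for \<eta>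
  proof -
    define P where "P = ({0..T} \<times> G) \<inter>
      (\<lambda>p. norm (snd p *v \<psi> (fst p) - \<psi> 0) - \<eta> * \<Lambda> (fst p)) -` {..0}"
    have cpt: "compact ({0..T} \<times> G)"
      by (intro compact_Times compact_Icc compact_G)
    have "continuous_on ({0..T} \<times> G) (\<lambda>p. \<psi> (fst p))" "continuous_on ({0..T} \<times> G) (\<lambda>p. \<Lambda> (fst p))"
      by (auto intro!: continuous_on_compose2[OF \<psi>_cont] continuous_on_compose2[OF \<Lambda>_cont]
          continuous_on_fst continuous_on_id)
    then have "closed P"
      unfolding P_def
      by (intro continuous_closed_preimage compact_imp_closed[OF cpt] closed_atMost continuous_on_diff
          continuous_on_norm mv.continuous_on continuous_on_mult continuous_on_const continuous_on_snd continuous_on_id)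
    moreover have "P = ({0..T} \<times> G) \<inter> P"
      by (auto simp: P_def)
    ultimately have "compact P"
      using compact_Int_closed[OF cpt] by metis
    then have "closed (fst ` P)"
      by (intro compact_imp_closed compact_continuous_image continuous_on_fst continuous_on_id)
    then have "T \<in> fst ` P"
    proof (rule closed_interval_induct[OF _ T])
      have "(0, mat 1) \<in> P"
        using T by (simp add: P_def \<Lambda>0 lie_group_of.one)
      then show "0 \<in> fst ` P"
        by force
      fix t assume t: "t \<in> fst ` P" "0 \<le> t" "t < T"
      then obtain W where W: "W \<in> G" "norm (W *v \<psi> t - \<psi> 0) \<le> \<eta> * \<Lambda> t"
        by (auto simp: P_def)
      \<comment> \<open>An increment of \<open>\<Lambda>\<close> below \<open>\<delta>\<close> makes
        \<open>exp_close\<close> applicable; the second bound makes the quadratic error at most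
        \<open>\<eta>\<close> times the increment. The added 1 avoids a zero denominator.\<close>
      define e where "e = min \<delta> (\<eta> / (b * K * C + 1))"
      have bKC: "b * K * C \<ge> 0"
        using b K C by simp
      have "e > 0"
        using C \<open>\<eta> > 0\<close> bKC by (simp add: e_def)
      then obtain d where d: "d > 0" "\<And>t'. t' \<in> {0..T} \<Longrightarrow> dist t' t < d \<Longrightarrow> dist (\<Lambda> t') (\<Lambda> t) < e"
        using \<Lambda>_cont t unfolding continuous_on_iff by (metis atLeastAtMost_iff less_imp_le)
      define t' where "t' = min T (t + d / 2)"
      have t': "t < t'" "t' \<le> T" "dist t' t < d"
        using d t by (auto simp: t'_def dist_real_def)
      have inc: "0 \<le> \<Lambda> t' - \<Lambda> t" "\<Lambda> t' - \<Lambda> t \<le> e"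
        using \<Lambda>_nonneg[of t t'] d(2)[of t'] t t' by (auto simp: dist_real_def)
      define D where "D = (t' - t) *\<^sub>R A + integral {t..t'} f *\<^sub>R B"
      have "D \<in> L"
        unfolding D_def using AB by (intro subspace_add[OF subspace] subspace_scale[OF subspace])
      \<comment> \<open>The new factor approximately undoes the evolution from \<open>t\<close> to
        \<open>t'\<close>, after which \<open>W\<close> leads back to the start.\<close>
      define W' where "W' = W ** matrix_exp (- D)"
      have "W' \<in> G"
        unfolding W'_def using W \<open>D \<in> L\<close> by (intro G_mult G_exp) (auto simp: subspace_neg[OF subspace])
      have "W' *v \<psi> t' - \<psi> 0 = (W *v \<psi> t - \<psi> 0) + W' *v (\<psi> t' - matrix_exp D *v \<psi> t)"
        by (simp add: mv.diff_right W'_def matrix_vector_mul_assoc flip: matrix_mul_assoc)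
      then have "norm (W' *v \<psi> t' - \<psi> 0) \<le> norm (W *v \<psi> t - \<psi> 0) + norm (W' *v (\<psi> t' - matrix_exp D *v \<psi> t))"
        by (metis norm_triangle_ineq)
      also have "norm (W' *v (\<psi> t' - matrix_exp D *v \<psi> t)) \<le> (b * K) * (C * (\<Lambda> t' - \<Lambda> t)\<^sup>2)"
        unfolding D_def using t t' inc b K e_def
        by (intro order_trans[OF G_bound[OF \<open>W' \<in> G\<close>]] mult_left_mono exp_close) auto
      also have "\<dots> = (b * K * C * (\<Lambda> t' - \<Lambda> t)) * (\<Lambda> t' - \<Lambda> t)"
        by (simp add: power2_eq_square)
      also have "\<dots> \<le> \<eta> * (\<Lambda> t' - \<Lambda> t)"
      proof (rule mult_right_mono)
        have "b * K * C * (\<Lambda> t' - \<Lambda> t) \<le> (b * K * C + 1) * (\<eta> / (b * K * C + 1))"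
          using inc bKC \<open>\<eta> > 0\<close> by (intro mult_mono) (auto simp: e_def)
        also have "\<dots> = \<eta>"
          using bKC by simp
        finally show "b * K * C * (\<Lambda> t' - \<Lambda> t) \<le> \<eta>" .
      qed (rule inc(1))
      finally have "norm (W' *v \<psi> t' - \<psi> 0) \<le> \<eta> * \<Lambda> t'"
        using W(2) by (simp add: right_diff_distrib)
      then have "(t', W') \<in> P"
        using t t' \<open>W' \<in> G\<close> by (auto simp: P_def)
      then show "\<exists>t'\<in>fst ` P. t < t' \<and> t' \<le> T"
        using t' by force
    qed
    then show ?thesis
      by (auto simp: P_def)
  qed
  have "continuous_on G (\<lambda>W. norm (W *v \<psi> T - \<psi> 0))"
    by (intro continuous_on_norm continuous_on_diff mv.continuous_on continuous_on_id continuous_on_const)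
  then have "\<exists>W\<in>G. \<forall>W'\<in>G. norm (W *v \<psi> T - \<psi> 0) \<le> norm (W' *v \<psi> T - \<psi> 0)"
    using lie_group_of.one[of L] by (intro continuous_attains_inf compact_G) auto
  then obtain W where W: "W \<in> G" "\<And>W'. W' \<in> G \<Longrightarrow> norm (W *v \<psi> T - \<psi> 0) \<le> norm (W' *v \<psi> T - \<psi> 0)"
    by auto
  have "norm (W *v \<psi> T - \<psi> 0) \<le> 0 + e" if "e > 0" for e
  proof -
    have \<Lambda>T: "\<Lambda> T \<ge> 0"
      using \<Lambda>_nonneg[of 0 T] T \<Lambda>0 by simp
    then obtain W' where W': "W' \<in> G" "norm (W' *v \<psi> T - \<psi> 0) \<le> e / (\<Lambda> T + 1) * \<Lambda> T"
      using approx[of "e / (\<Lambda> T + 1)"] \<open>e > 0\<close> by auto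
    have "e / (\<Lambda> T + 1) * \<Lambda> T \<le> e / (\<Lambda> T + 1) * (\<Lambda> T + 1)"
      using \<Lambda>T \<open>e > 0\<close> by (intro mult_left_mono) auto
    also have "\<dots> = e"
      using \<Lambda>T by simp
    finally show ?thesis
      using W(2)[OF W'(1)] W'(2) by linarith
  qed
  then have "norm (W *v \<psi> T - \<psi> 0) \<le> 0"
    by (rule field_le_epsilon)
  then have "W *v \<psi> T = \<psi> 0"
    by simp
  then have "\<psi> T = matrix_inv W *v \<psi> 0"
    using W(1) by (metis invertible_G matrix_inv_left matrix_vector_mul_assoc matrix_vector_mul_lid)
  then show ?thesis
    using W(1) by (intro bexI[of _ "matrix_inv W"]) auto
qed

end

section \<open>Realising semigroup elements by piecewise constant controls\<close>

text \<open>A piece appended later in time multiplies the propagator on the left, the side on which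
  \<open>semigroup_of\<close> grows. At \<open>T\<close> itself the old control value is kept, which
  affects the new integrand at a single point only.\<close>

lemma bilinear_solution_append:
  fixes A B :: "complex^'n^'n" and u :: real
  assumes sol: "bilinear_solution A B f \<psi>" and adm: "admissible_control f" and "0 \<le> T"
  defines "f' \<equiv> \<lambda>s. if s \<le> T then f s else u"
    and "\<psi>' \<equiv> \<lambda>s. if s \<le> T then \<psi> s else matrix_exp ((s - T) *\<^sub>R (A + u *\<^sub>R B)) *v \<psi> T"
  shows "bilinear_solution A B f' \<psi>'" and "admissible_control f'"
proof -
  let ?X = "A + u *\<^sub>R B"
  let ?\<phi> = "\<lambda>s. matrix_exp ((s - T) *\<^sub>R ?X) *v \<psi> T"
  have deriv: "(?\<phi> has_vector_derivative ?X *v ?\<phi> s) (at s within S)" for s S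
  proof -
    have "((\<lambda>s. s - T) has_vector_derivative 1) (at s within S)"
      by (auto intro!: derivative_eq_intros)
    from vector_diff_chain_within[OF this matrix_exp_has_vector_derivative]
    have "((\<lambda>s. matrix_exp ((s - T) *\<^sub>R ?X)) has_vector_derivative ?X ** matrix_exp ((s - T) *\<^sub>R ?X)) (at s within S)"
      by (simp add: o_def)
    from bounded_linear.has_vector_derivative[OF mv.bounded_linear_left this]
    show ?thesis
      by (simp add: matrix_vector_mul_assoc)
  qed
  have \<psi>'_eq: "\<psi>' s = ?\<phi> s" if "T \<le> s" for s
    using that by (auto simp: \<psi>'_def)
  have cont1: "continuous_on {0..T} \<psi>'"
  proof (rule continuous_on_eq)
    show "continuous_on {0..T} \<psi>"
      using sol unfolding bilinear_solution_def by (auto intro: continuous_on_subset)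
  qed (simp add: \<psi>'_def)
  have cont2: "continuous_on {T..} \<psi>'"
  proof (rule continuous_on_eq)
    show "continuous_on {T..} ?\<phi>"
      by (rule continuous_on_vector_derivative[OF deriv])
  qed (simp add: \<psi>'_eq)
  have "continuous_on ({0..T} \<union> {T..}) \<psi>'"
    by (intro continuous_on_closed_Un cont1 cont2) auto
  moreover have "{0..T} \<union> {T..} = {0..}"
    using \<open>0 \<le> T\<close> by auto
  moreover have "((\<lambda>s. (A + f' s *\<^sub>R B) *v \<psi>' s) has_integral (\<psi>' t - \<psi>' 0)) {0..t}" if "0 \<le> t" for t
  proof -
    have first: "((\<lambda>s. (A + f' s *\<^sub>R B) *v \<psi>' s) has_integral (\<psi>' r - \<psi>' 0)) {0..r}" if r: "0 \<le> r" "r \<le> T" for r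
    proof (rule has_integral_eq)
      show "((\<lambda>s. (A + f s *\<^sub>R B) *v \<psi> s) has_integral (\<psi>' r - \<psi>' 0)) {0..r}"
        using sol r \<open>0 \<le> T\<close> by (simp add: bilinear_solution_def \<psi>'_def)
    qed (use r in \<open>auto simp: f'_def \<psi>'_def\<close>)
    show ?thesis
    proof (cases "t \<le> T")
      case False
      have "((\<lambda>s. ?X *v ?\<phi> s) has_integral (?\<phi> t - ?\<phi> T)) {T..t}"
        using False by (intro fundamental_theorem_of_calculus deriv) simp
      then have "((\<lambda>s. (A + f' s *\<^sub>R B) *v \<psi>' s) has_integral (?\<phi> t - ?\<phi> T)) {T..t}"
        by (rule has_integral_spike_finite[of "{T}", rotated 2]) (auto simp: f'_def \<psi>'_def)
      then have "((\<lambda>s. (A + f' s *\<^sub>R B) *v \<psi>' s) has_integral (\<psi>' t - \<psi>' T)) {T..t}"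
        using False by (simp add: \<psi>'_eq)
      from has_integral_combine[OF \<open>0 \<le> T\<close> _ first[OF \<open>0 \<le> T\<close> order_refl] this] False
      show ?thesis
        by simp
    qed (use first that in simp)
  qed
  ultimately show "bilinear_solution A B f' \<psi>'"
    unfolding bilinear_solution_def by simp
  show "admissible_control f'"
    unfolding admissible_control_def
  proof (intro allI impI)
    fix S :: real assume "0 \<le> S"
    let ?m = "max S T"
    have "f absolutely_integrable_on {0..T}"
      using adm \<open>0 \<le> T\<close> by (simp add: admissible_control_def)
    then have left: "f' absolutely_integrable_on {0..T}"
      by (rule absolutely_integrable_spike[of _ _ "{}"]) (auto simp: f'_def)
    have "(\<lambda>_. u) absolutely_integrable_on {T..?m}"
      by (intro absolutely_integrable_on_const) simp
    then have "f' absolutely_integrable_on {T..?m}"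
      by (rule absolutely_integrable_spike[of _ _ "{T}"]) (auto simp: f'_def)
    with left have "f' absolutely_integrable_on ({0..T} \<union> {T..?m})"
      by (rule absolutely_integrable_Un)
    then show "f' absolutely_integrable_on {0..S}"
      by (rule absolutely_integrable_on_subinterval) auto
  qed
qed

lemma semigroup_of_realised:
  assumes "U \<in> semigroup_of (range (\<lambda>u. A + u *\<^sub>R B))"
  shows "\<exists>T\<ge>0. \<exists>f \<psi>. admissible_control f \<and> bilinear_solution A B f \<psi> \<and> \<psi> 0 = x \<and> \<psi> T = U *v x"
  using assms
proof (induction rule: semigroup_of.induct)
  case one
  \<comment> \<open>Duration zero is enough here, yet a solution has to be given on the whole
    half-line; the zero control provides one.\<close>
  let ?\<psi> = "\<lambda>s. matrix_exp (s *\<^sub>R A) *v x"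
  have deriv: "(?\<psi> has_vector_derivative A *v ?\<psi> s) (at s within S)" for s S
    using bounded_linear.has_vector_derivative[OF mv.bounded_linear_left matrix_exp_has_vector_derivative]
    by (simp add: matrix_vector_mul_assoc)
  have "bilinear_solution A B (\<lambda>_. 0) ?\<psi>"
    unfolding bilinear_solution_def
  proof (intro conjI allI impI)
    show "continuous_on {0..} ?\<psi>"
      by (rule continuous_on_vector_derivative[OF deriv])
    show "((\<lambda>s. (A + 0 *\<^sub>R B) *v ?\<psi> s) has_integral (?\<psi> t - ?\<psi> 0)) {0..t}" if "0 \<le> t" for t
      using fundamental_theorem_of_calculus[OF that deriv] by simp
  qed
  moreover have "admissible_control (\<lambda>_. 0)"
    by (simp add: admissible_control_def)
  ultimately show ?case
    by (intro exI[of _ "0 :: real"] exI[of _ "\<lambda>_. 0"] exI[of _ ?\<psi>] conjI) simp_all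
next
  case (mult t X U)
  then obtain T f \<psi> where f: "T \<ge> 0" "admissible_control f" "bilinear_solution A B f \<psi>" "\<psi> 0 = x" "\<psi> T = U *v x"
    by auto
  obtain u where u: "X = A + u *\<^sub>R B"
    using mult by auto
  let ?f = "\<lambda>s. if s \<le> T then f s else u"
  let ?\<psi> = "\<lambda>s. if s \<le> T then \<psi> s else matrix_exp ((s - T) *\<^sub>R (A + u *\<^sub>R B)) *v \<psi> T"
  have "bilinear_solution A B ?f ?\<psi>" "admissible_control ?f"
    using bilinear_solution_append[OF f(3,2,1)] by blast+
  moreover have "?\<psi> (T + t) = (matrix_exp (t *\<^sub>R X) ** U) *v x"
    using f mult u by (cases "t = 0") (simp_all add: matrix_vector_mul_assoc)
  ultimately show ?case
    using f mult by (intro exI[of _ "T + t"] exI[of _ ?f] exI[of _ ?\<psi>] conjI) simp_all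
qed

section \<open>Reachability\<close>

lemma lie_subalgebra_hull: "lie_subalgebra (lie_subalgebra hull S)"
proof (rule hull_in)
  show "lie_subalgebra (\<Inter>T)" if "Ball T lie_subalgebra" for T :: "(complex^'a^'a) set set"
    using that by (auto simp: lie_subalgebra_def intro: subspace_Inter)
qed

lemma cscale_add: "cscale c (X + r *\<^sub>R Y) = cscale c X + r *\<^sub>R cscale c Y"
  by (simp add: cscale_def vec_eq_iff algebra_simps)

lemma cscale_mult_vector: "c *s (X *v x) = cscale c X *v x"
  by (simp add: cscale_def vec_eq_iff matrix_vector_mult_def sum_distrib_left mult.assoc)

lemma cscale_minus_i: "cscale (- \<i> * of_real J) X = (- J) *\<^sub>R cscale \<i> X"
  by (simp add: cscale_def vec_eq_iff complex_eq_iff)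

lemma schroedinger_solution_iff:
  "schroedinger_solution J H0 H1 f \<psi> \<longleftrightarrow>
     bilinear_solution (cscale (- \<i> * of_real J) H0) (cscale (- \<i> * of_real J) H1) f \<psi>"
  unfolding schroedinger_solution_def bilinear_solution_def cscale_mult_vector cscale_add ..

text \<open>The generators reachable by constant controls give the same Lie algebra as the
  Hamiltonians: \<open>A\<close> and \<open>B\<close> are recovered from \<open>u = 0\<close> and
  \<open>u = 1\<close>, and \<open>J \<noteq> 0\<close> permits rescaling.\<close>

lemma dynamical_lie_algebra_eq:
  fixes H0 H1 :: "complex^'b::finite^'b"
  assumes "J \<noteq> 0"
  defines "A \<equiv> cscale (- \<i> * of_real J) H0" and "B \<equiv> cscale (- \<i> * of_real J) H1"
  shows "dynamical_lie_algebra H0 H1 = lie_subalgebra hull (range (\<lambda>u. A + u *\<^sub>R B))" (is "?L = ?M")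
proof
  have L: "subspace ?L" "subspace ?M"
    using lie_subalgebra_hull unfolding dynamical_lie_algebra_def lie_subalgebra_def by blast+
  have gens: "cscale \<i> H0 \<in> ?L" "cscale \<i> H1 \<in> ?L"
    unfolding dynamical_lie_algebra_def by (auto intro: hull_inc)
  have "A + u *\<^sub>R B \<in> ?L" for u
    unfolding A_def B_def cscale_minus_i
    using gens by (intro subspace_add[OF L(1)] subspace_scale[OF L(1)])
  then show "?M \<subseteq> ?L"
    by (intro hull_minimal) (auto simp: dynamical_lie_algebra_def lie_subalgebra_hull)
  have M: "A + u *\<^sub>R B \<in> ?M" for u
    by (auto intro: hull_inc)
  have "A \<in> ?M"
    using M[of 0] by simp
  moreover have "B \<in> ?M"
    using subspace_diff[OF L(2) M[of 1] M[of 0]] by simp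
  moreover have "cscale \<i> H0 = (- 1 / J) *\<^sub>R A" "cscale \<i> H1 = (- 1 / J) *\<^sub>R B"
    unfolding A_def B_def cscale_minus_i using \<open>J \<noteq> 0\<close> by simp_all
  ultimately have "{cscale \<i> H0, cscale \<i> H1} \<subseteq> ?M"
    by (auto simp only: intro!: subspace_scale[OF L(2)])
  then show "?L \<subseteq> ?M"
    unfolding dynamical_lie_algebra_def by (intro hull_minimal lie_subalgebra_hull)
qed

theorem asymptotically_reachable_imp_finite_time_reachable:
  fixes H0 H1 :: "complex^'b::finite^'b"
  assumes "J \<noteq> 0" and compact: "compact (lie_group_of (dynamical_lie_algebra H0 H1))"
    and reach: "asymptotically_reachable J H0 H1 \<psi>0 \<psi>d"
  shows "finite_time_reachable J H0 H1 \<psi>0 \<psi>d"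
proof -
  define A B where AB: "A = cscale (- \<i> * of_real J) H0" "B = cscale (- \<i> * of_real J) H1"
  define L where "L = dynamical_lie_algebra H0 H1"
  have L: "L = lie_subalgebra hull (range (\<lambda>u. A + u *\<^sub>R B))"
    unfolding L_def AB by (rule dynamical_lie_algebra_eq[OF \<open>J \<noteq> 0\<close>])
  interpret compact_matrix_lie_group L
    using compact by unfold_locales (simp_all add: L_def dynamical_lie_algebra_def lie_subalgebra_hull)
  have gens: "A + u *\<^sub>R B \<in> L" for u
    unfolding L by (auto intro: hull_inc)
  have AL: "A \<in> L"
    using gens[of 0] by simp
  have BL: "B \<in> L"
    using subspace_diff[OF subspace gens[of 1] gens[of 0]] by simp
  obtain f \<psi> where f: "admissible_control f" "bilinear_solution A B f \<psi>" "\<psi> 0 = \<psi>0"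
    and lim: "((\<lambda>t. (cmod (braket \<psi>d (\<psi> t)))\<^sup>2) \<longlongrightarrow> 1) at_top"
    using reach unfolding asymptotically_reachable_def schroedinger_solution_iff AB by auto
  \<comment> \<open>Integer times suffice: the propagators at these times have a subsequence
    converging in \<open>G\<close>, along which the overlap tends both to 1 and to the overlap of
    the limit state.\<close>
  have "\<forall>n :: nat. \<exists>U\<in>G. \<psi> (real n) = U *v \<psi>0"
    using bilinear_solution_in_orbit[OF AL BL f(2,1)] f(3) by simp
  then obtain U where U: "\<And>n. U n \<in> G" "\<And>n. \<psi> (real n) = U n *v \<psi>0"
    by metis
  obtain V r where V: "V \<in> G" "strict_mono r" "(U \<circ> r) \<longlonglongrightarrow> V"
    using compact_G U(1) unfolding compact_def by metis
  have "(\<lambda>n. U (r n) *v \<psi>0) \<longlonglongrightarrow> V *v \<psi>0"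
    using V(3) by (intro mv.tendsto tendsto_const) (simp add: o_def)
  then have "(\<lambda>n. (cmod (braket \<psi>d (U (r n) *v \<psi>0)))\<^sup>2) \<longlonglongrightarrow> (cmod (braket \<psi>d (V *v \<psi>0)))\<^sup>2"
    unfolding braket_def by (intro tendsto_intros)
  moreover have "(\<lambda>n. (cmod (braket \<psi>d (U (r n) *v \<psi>0)))\<^sup>2) \<longlonglongrightarrow> 1"
  proof -
    have "filterlim (\<lambda>n. real (r n)) at_top sequentially"
      using filterlim_compose[OF filterlim_real_sequentially filterlim_subseq[OF V(2)]] .
    from filterlim_compose[OF lim this] show ?thesis
      by (simp add: U(2))
  qed
  ultimately have "(cmod (braket \<psi>d (V *v \<psi>0)))\<^sup>2 = 1"
    by (rule LIMSEQ_unique)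
  moreover have "V \<in> semigroup_of (range (\<lambda>u. A + u *\<^sub>R B))"
    using V(1) G_subset_semigroup_of[OF L] by blast
  then obtain T g \<phi> where "T \<ge> 0" "admissible_control g" "bilinear_solution A B g \<phi>" "\<phi> 0 = \<psi>0" "\<phi> T = V *v \<psi>0"
    using semigroup_of_realised by blast
  ultimately show ?thesis
    unfolding finite_time_reachable_def schroedinger_solution_iff AB by metis
qed

theorem proposition1:
  fixes N :: nat and J :: real and site :: "nat \<Rightarrow> 'n::finite"
    and \<psi>0 \<psi>d :: "complex ^ ('n \<Rightarrow> 2)"
  assumes "N \<ge> 2" and "bij_betw site {1..N} UNIV" and "J \<noteq> 0"
    and "norm \<psi>0 = 1" and "norm \<psi>d = 1"
    and "compact (lie_group_of (dynamical_lie_algebra (ising_H0 N site) (ising_H1 N site)))"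
    and "asymptotically_reachable J (ising_H0 N site) (ising_H1 N site) \<psi>0 \<psi>d"
  shows "finite_time_reachable J (ising_H0 N site) (ising_H1 N site) \<psi>0 \<psi>d"
  using assms(3,6,7) by (rule asymptotically_reachable_imp_finite_time_reachable)

end
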